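(* For each $\mathbb F\in\{\mathbb C,\mathbb R,\mathbb H\}$, the space $\mathcal S^{\Lambda\mathrm{nt}}_{\mathbb F}$ of $\Lambda$-non-trivial self-adjoint unitaries of class $\mathbb F$ (defined in the context) has exactly one path component: $$\pi_0(\mathcal S^{\Lambda\mathrm{nt}}_{\mathbb F})\cong\{0\}.$$
   Context: $\mathcal H$ is an infinite-dimensional separable complex Hilbert space, $\mathcal B$ its bounded linear operators with the operator norm topology, $\mathcal K$ the compact operators. $\Lambda\in\mathcal B$ is a fixed self-adjoint projection with infinite-dimensional range and kernel; $\Lambda^\perp=\mathbb 1-\Lambda$. $C,J:\mathcal H\to\mathcal H$ are fixed anti-unitary operators with $C^2=\mathbb 1$, $J^2=-\mathbb 1$, both commuting with $\Lambda$. A self-adjoint unitary (SAU) is called non-trivial iff both its $+1$ and $-1$ eigenspaces are infinite-dimensional. A SAU $U$ on $\mathcal H$ is called $\Lambda$-non-trivial iff there is a SAU $V$ on $\mathcal H$ such that (1) $[V,\Lambda]=0$; (2) the restrictions of $V$ to $\mathrm{im}\,\Lambda$ and to $\mathrm{im}\,\Lambda^\perp$ are both non-trivial SAUs (on these Hilbert spaces); (3) $U-V\in\mathcal K$. $\mathcal S^{\Lambda\mathrm{nt}}$ is the set of $\Lambda$-non-trivial SAUs, and $\mathcal S^{\Lambda\mathrm{nt}}_{\mathbb C}=\mathcal S^{\Lambda\mathrm{nt}}$, $\mathcal S^{\Lambda\mathrm{nt}}_{\mathbb R}=\{U\in\mathcal S^{\Lambda\mathrm{nt}}:UC=CU\}$,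 $\mathcal S^{\Lambda\mathrm{nt}}_{\mathbb H}=\{U\in\mathcal S^{\Lambda\mathrm{nt}}:UJ=JU\}$, all with the operator norm subspace topology. $\pi_0$ denotes the set of path components. *)

theory Defs
  imports "HOL-Analysis.Analysis"
begin

text \<open>
  Complex Hilbert spaces. The class extends the real inner product spaces of the library, so that
  norm, topology, completeness and the Banach space \<open>'a \<Rightarrow>\<^sub>L 'a\<close> with the operator norm are the
  library's: since \<open>inner x y = Re (cinner x y)\<close>, the norm is \<open>sqrt (Re (cinner x x))\<close>, where
  \<open>cinner x x\<close> is real by hermitian symmetry. The scalar product is antilinear in its first and
  linear in its second argument.
\<close>

class complex_hilbert_space = real_inner + complete_space +
  fixes scaleC :: "complex \<Rightarrow> 'a \<Rightarrow> 'a"  (infixr \<open>*\<^sub>C\<close> 75)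
    and cinner :: "'a \<Rightarrow> 'a \<Rightarrow> complex"
  assumes scaleC_add_right: "a *\<^sub>C (x + y) = a *\<^sub>C x + a *\<^sub>C y"
    and scaleC_add_left: "(a + b) *\<^sub>C x = a *\<^sub>C x + b *\<^sub>C x"
    and scaleC_scaleC: "a *\<^sub>C b *\<^sub>C x = (a * b) *\<^sub>C x"
    and scaleC_one: "1 *\<^sub>C x = x"
    and scaleR_scaleC: "scaleR r x = complex_of_real r *\<^sub>C x"
    and cinner_commute: "cinner x y = cnj (cinner y x)"
    and cinner_add_right: "cinner x (y + z) = cinner x y + cinner x z"
    and cinner_scaleC_right: "cinner x (a *\<^sub>C y) = a * cinner x y"
    and inner_eq_Re_cinner: "inner x y = Re (cinner x y)"

global_interpretation complex_vector:
  vector_space "scaleC :: complex \<Rightarrow> 'a \<Rightarrow> 'a::complex_hilbert_space"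
  by unfold_locales
    (simp_all add: scaleC_add_right scaleC_add_left scaleC_scaleC scaleC_one)

text \<open>Used for complex subspaces \<open>S\<close> only.\<close>

definition infinite_dimensional :: "'a::complex_hilbert_space set \<Rightarrow> bool"
  where "infinite_dimensional S \<longleftrightarrow> \<not> (\<exists>B. finite B \<and> complex_vector.span B = S)"

text \<open>Elements of \<open>'a \<Rightarrow>\<^sub>L 'a\<close> are bounded and real-linear; complex linearity is added as a predicate.\<close>

definition clinear :: "('a::complex_hilbert_space \<Rightarrow> 'a) \<Rightarrow> bool"
  where "clinear f \<longleftrightarrow> Vector_Spaces.linear scaleC scaleC f"

definition antiunitary :: "('a::complex_hilbert_space \<Rightarrow> 'a) \<Rightarrow> bool"
  where "antiunitary f \<longleftrightarrow>
    (\<forall>x y. f (x + y) = f x + f y) \<and> (\<forall>a x. f (a *\<^sub>C x) = cnj a *\<^sub>C f x) \<and>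
    surj f \<and> (\<forall>x y. cinner (f x) (f y) = cnj (cinner x y))"

definition selfadjoint_projection :: "('a::complex_hilbert_space \<Rightarrow>\<^sub>L 'a) \<Rightarrow> bool"
  where "selfadjoint_projection P \<longleftrightarrow> clinear (blinfun_apply P) \<and> P o\<^sub>L P = P \<and>
    (\<forall>x y. cinner (P x) y = cinner x (P y))"

definition compact_operator :: "('a::complex_hilbert_space \<Rightarrow>\<^sub>L 'a) \<Rightarrow> bool"
  where "compact_operator A \<longleftrightarrow> clinear (blinfun_apply A) \<and> compact (closure (blinfun_apply A ` cball 0 1))"

text \<open>
  \<open>sau_on S f\<close>: the restriction of \<open>f\<close> to the closed subspace \<open>S\<close> is a self-adjoint unitary on the
  Hilbert space \<open>S\<close>; unitary means linear, onto and preserving the scalar product.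
\<close>

definition sau_on :: "'a::complex_hilbert_space set \<Rightarrow> ('a \<Rightarrow> 'a) \<Rightarrow> bool"
  where "sau_on S f \<longleftrightarrow>
    (\<forall>x\<in>S. \<forall>y\<in>S. f (x + y) = f x + f y) \<and> (\<forall>a. \<forall>x\<in>S. f (a *\<^sub>C x) = a *\<^sub>C f x) \<and>
    f ` S = S \<and> (\<forall>x\<in>S. \<forall>y\<in>S. cinner (f x) (f y) = cinner x y) \<and>
    (\<forall>x\<in>S. \<forall>y\<in>S. cinner (f x) y = cinner x (f y))"

definition nontrivial_sau_on :: "'a::complex_hilbert_space set \<Rightarrow> ('a \<Rightarrow> 'a) \<Rightarrow> bool"
  where "nontrivial_sau_on S f \<longleftrightarrow> sau_on S f \<and>
    infinite_dimensional {x\<in>S. f x = x} \<and> infinite_dimensional {x\<in>S. f x = - x}"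

definition \<Lambda>_nontrivial ::
    "('a::complex_hilbert_space \<Rightarrow>\<^sub>L 'a) \<Rightarrow> ('a \<Rightarrow>\<^sub>L 'a) \<Rightarrow> bool"
  where "\<Lambda>_nontrivial \<Lambda> U \<longleftrightarrow> (\<exists>V :: 'a \<Rightarrow>\<^sub>L 'a. sau_on UNIV (blinfun_apply V) \<and>
    V o\<^sub>L \<Lambda> = \<Lambda> o\<^sub>L V \<and>
    nontrivial_sau_on (range (blinfun_apply \<Lambda>)) (blinfun_apply V) \<and>
    nontrivial_sau_on (range (blinfun_apply (id_blinfun - \<Lambda>))) (blinfun_apply V) \<and>
    compact_operator (U - V))"

definition \<Lambda>nt_saus :: "('a::complex_hilbert_space \<Rightarrow>\<^sub>L 'a) \<Rightarrow> ('a \<Rightarrow>\<^sub>L 'a) set"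
  where "\<Lambda>nt_saus \<Lambda> = {U. sau_on UNIV (blinfun_apply U) \<and> \<Lambda>_nontrivial \<Lambda> U}"

datatype scalar_class = Class_C | Class_R | Class_H

text \<open>\<open>C\<close> is the real structure (\<open>C\<^sup>2 = 1\<close>), \<open>J\<close> the quaternionic structure (\<open>J\<^sup>2 = -1\<close>).\<close>

fun \<Lambda>nt_saus_of_class ::
    "scalar_class \<Rightarrow> ('a::complex_hilbert_space \<Rightarrow>\<^sub>L 'a) \<Rightarrow> ('a \<Rightarrow> 'a) \<Rightarrow> ('a \<Rightarrow> 'a) \<Rightarrow> ('a \<Rightarrow>\<^sub>L 'a) set"
  where
    "\<Lambda>nt_saus_of_class Class_C \<Lambda> C J = \<Lambda>nt_saus \<Lambda>"
  | "\<Lambda>nt_saus_of_class Class_R \<Lambda> C J = {U \<in> \<Lambda>nt_saus \<Lambda>. blinfun_apply U \<circ> C = C \<circ> blinfun_apply U}"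
  | "\<Lambda>nt_saus_of_class Class_H \<Lambda> C J = {U \<in> \<Lambda>nt_saus \<Lambda>. blinfun_apply U \<circ> J = J \<circ> blinfun_apply U}"

text \<open>Path components with respect to the subspace topology (no base point).\<close>

definition pi0 :: "'a::topological_space set \<Rightarrow> 'a set set"
  where "pi0 S = path_components_of (top_of_set S)"

end

(*
  Proof idea. Complex linearity and commutation with C or J are commutation with a small set G of
  real-linear isometries, so everything takes place in the real Hilbert space and treats the three
  classes alike.

  Let y = 2 \<Lambda> - 1 and split U = A + K into the parts commuting and anticommuting with y. Then K is
  compact, A K + K A = 0 and A^2 + K^2 = 1. Let p be the projection onto ker A = ker (K^2 - 1); on
  its complement |K| < 1, and U = (A / sqrt (1 - K^2)) sqrt (1 - t^2 K^2) + t K at t = 1 is deformed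
  to t = 0. On the range of p, K is itself a self-adjoint unitary anticommuting with y, so
  cos s K + sin s y leads to y. This deforms U, through compact perturbations of U, to a self-adjoint
  unitary commuting with \<Lambda>; no Fredholm index has to be cancelled.

  A self-adjoint unitary commuting with \<Lambda> is given by a projection in each of ran \<Lambda> and ran (1 - \<Lambda>),
  of infinite rank and corank. Two orthogonal such projections P, R are joined by rotating an
  orthonormal basis of ran P to one of ran R. For arbitrary P, Q one chooses infinite, mutually
  orthogonal sequences e_n in ker P and f_n in ker Q and rotates along P, span e, span f, Q.
*)
theory Submission
  imports Defs
begin

section \<open>Orthonormal families\<close>

text \<open>The deformation is made from \<open>U\<close> and \<Lambda> alone, by square roots that
  commute with everything commuting with the operator under the root, so compatibility with C or J
  costs nothing there. The witness \<open>V\<close> in the definition need not commute with C or J.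
  It enters only through the compactness of \<open>U - V\<close>: this makes the commutator of
  \<open>U\<close> with \<Lambda> compact, and it keeps the four eigenspaces infinite-dimensional at
  the end of the path.

  An index could only hide in the kernel of A. There K exchanges the range and the kernel of
  \<Lambda>, so the two halves are balanced and y can be reached; since p is compact, what happens
  on its range does not affect infinite-dimensionality.

  Rotations of projections have to commute with G as well. Orthonormal bases are therefore assembled
  from whole orbits of the scalars. Separability makes each such basis of an infinite-dimensional
  range a sequence, so that any two have the same index set.\<close>

instance complex_hilbert_space \<subseteq> banach ..

definition orthonormal_on :: "'i set \<Rightarrow> ('i \<Rightarrow> 'a::real_inner) \<Rightarrow> bool"
  where "orthonormal_on I b \<longleftrightarrow> (\<forall>i\<in>I. \<forall>j\<in>I. inner (b i) (b j) = (if i = j then 1 else 0))"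

lemma orthonormal_onD:
  "orthonormal_on I b \<Longrightarrow> i \<in> I \<Longrightarrow> j \<in> I \<Longrightarrow> inner (b i) (b j) = (if i = j then 1 else 0)"
  by (simp add: orthonormal_on_def)

lemma norm_sum_orthonormal:
  assumes "orthonormal_on I b" "finite F" "F \<subseteq> I"
  shows "(norm (\<Sum>i\<in>F. r i *\<^sub>R b i))\<^sup>2 = (\<Sum>i\<in>F. (r i)\<^sup>2)"
proof -
  have "inner (\<Sum>i\<in>F. r i *\<^sub>R b i) (\<Sum>j\<in>F. r j *\<^sub>R b j)
      = (\<Sum>i\<in>F. \<Sum>j\<in>F. if i = j then r i * r j else 0)"
    unfolding inner_sum_left inner_sum_right
    using assms by (intro sum.cong refl) (auto simp: orthonormal_on_def subset_iff)
  also have "\<dots> = (\<Sum>i\<in>F. (r i)\<^sup>2)"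
    using assms(2) by (simp add: sum.delta power2_eq_square)
  finally show ?thesis by (simp add: power2_norm_eq_inner)
qed

lemma bessel_finite:
  assumes "orthonormal_on I b" "finite F" "F \<subseteq> I"
  shows "(\<Sum>i\<in>F. (inner (b i) x)\<^sup>2) \<le> (norm x)\<^sup>2"
proof -
  let ?y = "\<Sum>i\<in>F. inner (b i) x *\<^sub>R b i"
  have "0 \<le> (norm (x - ?y))\<^sup>2" by simp
  also have "\<dots> = (norm x)\<^sup>2 - 2 * inner x ?y + (norm ?y)\<^sup>2"
    by (simp add: power2_norm_eq_inner inner_diff_left inner_diff_right inner_commute)
  also have "inner x ?y = (\<Sum>i\<in>F. (inner (b i) x)\<^sup>2)"
    by (simp add: inner_sum_right power2_eq_square inner_commute)
  finally show ?thesis using norm_sum_orthonormal[OF assms, of "\<lambda>i. inner (b i) x"] by simp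
qed

text \<open>By Pythagoras the squared distance between two nested partial sums is a block of the
  convergent series of the \<open>(r i)\<^sup>2\<close>, so the net of partial sums is
  Cauchy.\<close>

lemma orthonormal_summable:
  fixes c :: "'i \<Rightarrow> 'a::{real_inner,banach}"
  assumes c: "orthonormal_on I c"
    and bd: "\<And>F. finite F \<Longrightarrow> F \<subseteq> I \<Longrightarrow> (\<Sum>i\<in>F. (r i)\<^sup>2) \<le> M"
  shows "(\<lambda>i. r i *\<^sub>R c i) summable_on I"
proof -
  let ?f = "\<lambda>i. r i *\<^sub>R c i"
  have "(\<lambda>i. (r i)\<^sup>2) summable_on I"
    by (rule nonneg_bdd_above_summable_on) (auto intro!: bdd_aboveI2[where M = M] bd)
  then obtain L where L: "(sum (\<lambda>i. (r i)\<^sup>2) \<longlongrightarrow> L) (finite_subsets_at_top I)"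
    unfolding summable_on_def has_sum_def by blast
  have "\<exists>P. eventually P (finite_subsets_at_top I) \<and>
      (\<forall>F F'. P F \<and> P F' \<longrightarrow> dist (sum ?f F) (sum ?f F') < e)" if "e > 0" for e
  proof -
    have "\<forall>\<^sub>F F in finite_subsets_at_top I. dist (\<Sum>i\<in>F. (r i)\<^sup>2) L < (e/4)\<^sup>2"
      using L that by (auto intro!: tendstoD)
    then obtain F0 where F0: "finite F0" "F0 \<subseteq> I"
      "\<And>F. finite F \<Longrightarrow> F0 \<subseteq> F \<Longrightarrow> F \<subseteq> I \<Longrightarrow> dist (\<Sum>i\<in>F. (r i)\<^sup>2) L < (e/4)\<^sup>2"
      unfolding eventually_finite_subsets_at_top by metis
    have near: "dist (sum ?f F) (sum ?f F0) < e / 2" if F: "finite F" "F0 \<subseteq> F" "F \<subseteq> I" for F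
    proof -
      have "(norm (sum ?f F - sum ?f F0))\<^sup>2 = (norm (sum ?f (F - F0)))\<^sup>2"
        using F by (simp add: sum_diff)
      also have "\<dots> = (\<Sum>i\<in>F - F0. (r i)\<^sup>2)"
        using F by (intro norm_sum_orthonormal[OF c]) auto
      also have "\<dots> = (\<Sum>i\<in>F. (r i)\<^sup>2) - (\<Sum>i\<in>F0. (r i)\<^sup>2)"
        using F by (simp add: sum_diff)
      also have "\<dots> < (e/4)\<^sup>2 + (e/4)\<^sup>2"
        using F0(3)[OF F] F0(3)[OF F0(1) subset_refl F0(2)] by (simp add: dist_real_def)
      also have "\<dots> \<le> (e/2)\<^sup>2" by (simp add: power2_eq_square)
      finally show ?thesis
        using \<open>e > 0\<close> power_less_imp_less_base[of "norm (sum ?f F - sum ?f F0)" 2 "e/2"]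
        by (simp add: dist_norm)
    qed
    show ?thesis
    proof (intro exI[of _ "\<lambda>F. finite F \<and> F0 \<subseteq> F \<and> F \<subseteq> I"] conjI allI impI)
      show "\<forall>\<^sub>F F in finite_subsets_at_top I. finite F \<and> F0 \<subseteq> F \<and> F \<subseteq> I"
        using F0 by (auto simp: eventually_finite_subsets_at_top)
      show "dist (sum ?f F) (sum ?f F') < e"
        if "(finite F \<and> F0 \<subseteq> F \<and> F \<subseteq> I) \<and> finite F' \<and> F0 \<subseteq> F' \<and> F' \<subseteq> I" for F F'
        using near[of F] near[of F'] that dist_triangle2[of "sum ?f F" "sum ?f F'" "sum ?f F0"]
        by auto
    qed
  qed
  then have "cauchy_filter (filtermap (sum ?f) (finite_subsets_at_top I))"
    by (simp add: cauchy_filter_metric_filtermap)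
  then obtain L' where "(sum ?f \<longlongrightarrow> L') (finite_subsets_at_top I)"
    using complete_uniform[where S = "UNIV :: 'a set"] complete_UNIV
    by (force simp add: filterlim_def)
  then show ?thesis
    using summable_on_def has_sum_def by blast
qed

text \<open>The partial isometry that takes \<open>b i\<close> to \<open>c i\<close> and kills the
  orthogonal complement of the family \<open>b\<close>; for \<open>c = b\<close> it is the
  orthogonal projection onto the closed span. \<open>Blinfun\<close> is meaningful once the sum is
  bounded and linear in \<open>x\<close>, which \<open>shift_op_apply\<close> derives for
  orthonormal families from Bessel's inequality.\<close>

definition shift_op :: "'i set \<Rightarrow> ('i \<Rightarrow> 'a) \<Rightarrow> ('i \<Rightarrow> 'a) \<Rightarrow> 'a::{real_inner,banach} \<Rightarrow>\<^sub>L 'a"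
  where "shift_op I b c = Blinfun (\<lambda>x. \<Sum>\<^sub>\<infinity>i\<in>I. inner (b i) x *\<^sub>R c i)"

context
  fixes I :: "'i set" and b c :: "'i \<Rightarrow> 'a::{real_inner,banach}"
  assumes b: "orthonormal_on I b" and c: "orthonormal_on I c"
begin

lemma shift_op_summable: "(\<lambda>i. inner (b i) x *\<^sub>R c i) summable_on I"
  by (rule orthonormal_summable[OF c bessel_finite[OF b]])

lemma shift_op_has_sum:
  "((\<lambda>i. inner (b i) x *\<^sub>R c i) has_sum (\<Sum>\<^sub>\<infinity>i\<in>I. inner (b i) x *\<^sub>R c i)) I"
  by (simp add: shift_op_summable)

lemma shift_op_apply: "shift_op I b c x = (\<Sum>\<^sub>\<infinity>i\<in>I. inner (b i) x *\<^sub>R c i)"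
proof -
  let ?W = "\<lambda>x. \<Sum>\<^sub>\<infinity>i\<in>I. inner (b i) x *\<^sub>R c i"
  have "bounded_linear ?W"
  proof (rule bounded_linear_intro[where K = 1])
    show "?W (x + y) = ?W x + ?W y" for x y
      using infsum_add[OF shift_op_summable shift_op_summable]
      by (simp add: inner_add_right scaleR_add_left)
    show "?W (r *\<^sub>R x) = r *\<^sub>R ?W x" for r x
      using infsum_scaleR_right[of r "\<lambda>i. inner (b i) x *\<^sub>R c i" I] by simp
    show "norm (?W x) \<le> norm x * 1" for x
    proof -
      have "(sum (\<lambda>i. inner (b i) x *\<^sub>R c i) \<longlongrightarrow> ?W x) (finite_subsets_at_top I)"
        using shift_op_has_sum by (simp add: has_sum_def)
      moreover have "norm (\<Sum>i\<in>F. inner (b i) x *\<^sub>R c i) \<le> norm x" if "finite F" "F \<subseteq> I" for F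
        using norm_sum_orthonormal[OF c that, of "\<lambda>i. inner (b i) x"] bessel_finite[OF b that, of x]
        by (auto intro: power2_le_imp_le)
      then have "\<forall>\<^sub>F F in finite_subsets_at_top I. norm (\<Sum>i\<in>F. inner (b i) x *\<^sub>R c i) \<le> norm x"
        by (intro eventually_finite_subsets_at_top_weakI)
      ultimately show ?thesis
        using Lim_norm_ubound[OF finite_subsets_at_top_neq_bot] by fastforce
    qed
  qed
  then show ?thesis by (simp add: shift_op_def bounded_linear_Blinfun_apply)
qed

lemma inner_shift_op_has_sum: "((\<lambda>i. inner (b i) x * inner y (c i)) has_sum inner y (shift_op I b c x)) I"
  using has_sum_bounded_linear[OF bounded_linear_inner_right shift_op_has_sum, of y x]
  by (simp add: shift_op_apply)

lemma inner_shift_op_basis: "i \<in> I \<Longrightarrow> inner (c i) (shift_op I b c x) = inner (b i) x"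
proof -
  assume i: "i \<in> I"
  have "((\<lambda>j. inner (b j) x * inner (c i) (c j)) has_sum inner (b i) x) I"
  proof -
    have "((\<lambda>j. inner (b j) x * inner (c i) (c j)) has_sum inner (b i) x) {i}"
      using i orthonormal_onD[OF c] by (auto intro!: has_sum_finiteI)
    then show ?thesis
      by (rule has_sum_cong_neutral[THEN iffD1, rotated -1]) (use i orthonormal_onD[OF c] in auto)
  qed
  then show ?thesis using inner_shift_op_has_sum[of x "c i"] has_sum_unique by blast
qed

lemma inner_shift_op_orthogonal:
  "(\<And>i. i \<in> I \<Longrightarrow> inner (c i) y = 0) \<Longrightarrow> inner y (shift_op I b c x) = 0"
  using has_sum_unique[OF inner_shift_op_has_sum[of x y]]
  by (metis (no_types, lifting) has_sum_0 inner_commute mult_zero_right)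

lemma shift_op_orthogonal: "(\<And>i. i \<in> I \<Longrightarrow> inner (b i) x = 0) \<Longrightarrow> shift_op I b c x = 0"
  by (auto simp: shift_op_apply intro!: infsum_0)

lemma shift_op_basis: "i \<in> I \<Longrightarrow> shift_op I b c (b i) = c i"
proof -
  assume i: "i \<in> I"
  have "((\<lambda>j. inner (b j) (b i) *\<^sub>R c j) has_sum c i) {i}"
    using i orthonormal_onD[OF b] by (auto intro!: has_sum_finiteI)
  then have "((\<lambda>j. inner (b j) (b i) *\<^sub>R c j) has_sum c i) I"
    by (rule has_sum_cong_neutral[THEN iffD1, rotated -1]) (use i orthonormal_onD[OF b] in auto)
  then show ?thesis by (simp add: shift_op_apply infsumI)
qed

lemma shift_op_closed:
  assumes "closed S" "subspace S" "\<And>i. i \<in> I \<Longrightarrow> c i \<in> S"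
  shows "shift_op I b c x \<in> S"
proof -
  have "(sum (\<lambda>i. inner (b i) x *\<^sub>R c i) \<longlongrightarrow> shift_op I b c x) (finite_subsets_at_top I)"
    using shift_op_has_sum by (simp add: has_sum_def shift_op_apply)
  then show ?thesis
    by (rule Lim_in_closed_set[OF assms(1), rotated -1])
      (auto intro!: eventually_finite_subsets_at_top_weakI subspace_sum subspace_scale assms
        simp: finite_subsets_at_top_neq_bot)
qed

end

lemma shift_op_adjoint:
  assumes "orthonormal_on I b" "orthonormal_on I c"
  shows "inner (shift_op I b c x) y = inner x (shift_op I c b y)"
  using has_sum_unique[OF inner_shift_op_has_sum[OF assms, of x y]]
    inner_shift_op_has_sum[OF assms(2,1), of y x]
  by (simp add: inner_commute mult.commute)

lemma shift_op_compose:
  assumes "orthonormal_on I b" "orthonormal_on I c" "orthonormal_on I d"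
  shows "shift_op I c d (shift_op I b c x) = shift_op I b d x"
  using assms by (simp add: shift_op_apply[of I c d] shift_op_apply[of I b d] inner_shift_op_basis
      cong: infsum_cong)

lemma shift_op_compose_0:
  assumes "orthonormal_on I a" "orthonormal_on I b" "orthonormal_on I c" "orthonormal_on I d"
    and "\<And>i j. i \<in> I \<Longrightarrow> j \<in> I \<Longrightarrow> inner (b i) (c j) = 0"
  shows "shift_op I c d (shift_op I a b x) = 0"
  by (rule shift_op_orthogonal[OF assms(3,4)], rule inner_shift_op_orthogonal[OF assms(1,2)])
    (use assms(5) in simp)

section \<open>Self-adjoint operators and orthogonal projections\<close>

definition selfadjoint :: "('a::{real_inner,banach} \<Rightarrow>\<^sub>L 'a) \<Rightarrow> bool"
  where "selfadjoint A \<longleftrightarrow> (\<forall>x y. inner (A x) y = inner x (A y))"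

lemma selfadjointD: "selfadjoint A \<Longrightarrow> inner (A x) y = inner x (A y)"
  by (simp add: selfadjoint_def)

definition is_proj :: "('a::{real_inner,banach} \<Rightarrow>\<^sub>L 'a) \<Rightarrow> bool"
  where "is_proj P \<longleftrightarrow> selfadjoint P \<and> (\<forall>x. P (P x) = P x)"

lemma is_projD: "is_proj P \<Longrightarrow> P (P x) = P x" "is_proj P \<Longrightarrow> inner (P x) y = inner x (P y)"
  by (auto simp: is_proj_def selfadjoint_def)

lemma is_proj_range: "is_proj P \<Longrightarrow> x \<in> range P \<longleftrightarrow> P x = x"
  by (metis is_projD(1) rangeE rangeI)

lemma is_proj_shift_op: "orthonormal_on I b \<Longrightarrow> is_proj (shift_op I b b)"
  by (simp add: is_proj_def selfadjoint_def shift_op_adjoint shift_op_compose)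

text \<open>The difference of the two operators at \<open>x\<close> lies in the range of
  \<open>P\<close> and is orthogonal to every \<open>b i\<close>, so maximality of the family makes
  it vanish.\<close>

lemma is_proj_eq_shift_op:
  assumes P: "is_proj P" and b: "orthonormal_on I b"
    and bP: "\<And>i. i \<in> I \<Longrightarrow> P (b i) = b i"
    and max: "\<And>x. P x = x \<Longrightarrow> (\<And>i. i \<in> I \<Longrightarrow> inner (b i) x = 0) \<Longrightarrow> x = 0"
  shows "P = shift_op I b b"
proof (rule blinfun_eqI)
  fix x
  let ?W = "shift_op I b b"
  have W: "?W y \<in> range P" for y
  proof (rule shift_op_closed[OF b b])
    have eq: "range P = {x. P x = x}" using is_proj_range[OF P] by auto
    show "closed (range P)"
      unfolding eq by (intro closed_Collect_eq continuous_intros)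
    show "subspace (range P)"
      unfolding eq by (auto simp: subspace_def blinfun.add_right blinfun.scaleR_right)
    show "b i \<in> range P" if "i \<in> I" for i using bP[OF that] by (metis rangeI)
  qed
  have PW: "P (?W y) = ?W y" for y using W is_proj_range[OF P] by blast
  have "P x - ?W x = 0"
  proof (rule max)
    show "P (P x - ?W x) = P x - ?W x"
      by (simp add: blinfun.diff_right is_projD[OF P] PW)
    show "inner (b i) (P x - ?W x) = 0" if "i \<in> I" for i
      using that bP[OF that] is_projD(2)[OF P, of "b i" x]
      by (simp add: inner_diff_right inner_shift_op_basis[OF b b])
  qed
  then show "P x = ?W x" by simp
qed

section \<open>Infinite-dimensional subspaces and compact operators\<close>

text \<open>The real span, with inclusion instead of equality: the notion is monotone in
  \<open>S\<close>, makes sense for sets that are not subspaces, and fits operators that are only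
  real-linear. \<open>inf_dim_iff\<close> relates it to the complex notion.\<close>

definition inf_dim :: "'a::real_vector set \<Rightarrow> bool"
  where "inf_dim S \<longleftrightarrow> \<not> (\<exists>B. finite B \<and> S \<subseteq> span B)"

lemma inf_dim_mono: "inf_dim S \<Longrightarrow> S \<subseteq> T \<Longrightarrow> inf_dim T"
  unfolding inf_dim_def by blast

lemma inf_dim_nonzero: "inf_dim S \<Longrightarrow> \<exists>x\<in>S. x \<noteq> 0"
  unfolding inf_dim_def by (metis empty_iff finite.emptyI span_zero subsetI)

text \<open>Each condition \<open>inner f x = 0\<close> costs at most one dimension: given one
  \<open>s\<close> with \<open>inner f s\<close> nonzero, every vector becomes orthogonal to
  \<open>f\<close> after subtracting a multiple of \<open>s\<close>.\<close>

lemma inf_dim_orthogonal: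
  fixes S :: "'a::real_inner set"
  assumes "finite F" "subspace S" "inf_dim S"
  shows "inf_dim {x\<in>S. \<forall>f\<in>F. inner f x = 0}"
  using assms(1)
proof (induction F)
  case empty
  then show ?case using assms(3) by simp
next
  case (insert f F)
  let ?T = "{x\<in>S. \<forall>f\<in>F. inner f x = 0}"
  have sub: "subspace ?T"
    using assms(2) by (auto simp: subspace_def inner_add_right)
  show ?case
  proof (rule ccontr)
    assume "\<not> ?thesis"
    then obtain B where B: "finite B" "{x\<in>S. \<forall>f\<in>insert f F. inner f x = 0} \<subseteq> span B"
      unfolding inf_dim_def by blast
    show False
    proof (cases "\<exists>s\<in>?T. inner f s \<noteq> 0")
      case False
      then have "?T \<subseteq> span B" using B(2) by auto
      then show False using insert.IH B(1) unfolding inf_dim_def by blast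
    next
      case True
      then obtain s where s: "s \<in> ?T" "inner f s \<noteq> 0" by blast
      have "x \<in> span (insert s B)" if x: "x \<in> ?T" for x
      proof -
        let ?c = "inner f x / inner f s"
        have "x - ?c *\<^sub>R s \<in> ?T"
          using sub s(1) x by (intro subspace_diff subspace_scale)
        moreover have "inner f (x - ?c *\<^sub>R s) = 0"
          using s(2) by (simp add: inner_diff_right)
        ultimately have "x - ?c *\<^sub>R s \<in> span B" using B(2) by blast
        then show ?thesis using span_breakdown_eq by blast
      qed
      then show False using insert.IH B(1) unfolding inf_dim_def
        by (meson finite_insert subsetI)
    qed
  qed
qed

lemma inf_dim_orthonormal:
  fixes b :: "'i \<Rightarrow> 'a::real_inner"
  assumes b: "orthonormal_on I b" and I: "infinite I" and S: "\<And>i. i \<in> I \<Longrightarrow> b i \<in> S"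
  shows "inf_dim S"
  unfolding inf_dim_def
proof
  assume "\<exists>B. finite B \<and> S \<subseteq> span B"
  then obtain B where B: "finite B" "S \<subseteq> span B" by blast
  have "inj_on b I"
    using b by (intro inj_onI) (metis orthonormal_onD zero_neq_one)
  then have "infinite (b ` I)" using I finite_imageD by blast
  moreover have "independent (b ` I)"
    unfolding dependent_explicit
  proof (clarsimp)
    fix t u v
    assume t: "finite t" "t \<subseteq> b ` I" "(\<Sum>v\<in>t. u v *\<^sub>R v) = 0" and v: "v \<in> t"
    have "inner v (\<Sum>w\<in>t. u w *\<^sub>R w) = (\<Sum>w\<in>t. if w = v then u w else 0)"
      unfolding inner_sum_right
    proof (intro sum.cong refl)
      fix w assume w: "w \<in> t"
      obtain i j where "v = b i" "w = b j" "i \<in> I" "j \<in> I" using t(2) v w by blast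
      then show "inner v (u w *\<^sub>R w) = (if w = v then u w else 0)"
        using orthonormal_onD[OF b, of i j] orthonormal_onD[OF b, of i i] by (cases "i = j") auto
    qed
    then show "u v = 0" using t v by (simp add: sum.delta)
  qed
  ultimately show False
    using independent_span_bound[OF B(1), of "b ` I"] S B(2) by blast
qed

text \<open>Zorn's lemma for an arbitrary symmetric relation, since three kinds of orthogonality
  need it: of vectors, of orbits, and of pairs of orbits. If no element of \<open>X\<close> is
  related to itself, the last clause says that nothing in \<open>X\<close> is related to all of
  \<open>B\<close>.\<close>

lemma ex_maximal_pairwise:
  assumes sym: "\<And>x y. r x y \<Longrightarrow> r y x"
  shows "\<exists>B\<subseteq>X. pairwise r B \<and> (\<forall>x\<in>X. (\<forall>y\<in>B. r x y) \<longrightarrow> x \<in> B)"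
proof -
  let ?A = "{B. B \<subseteq> X \<and> pairwise r B}"
  have "\<exists>M\<in>?A. \<forall>Y\<in>?A. M \<subseteq> Y \<longrightarrow> Y = M"
  proof (rule subset_Zorn')
    fix C assume C: "subset.chain ?A C"
    have sub: "M \<subseteq> X" "pairwise r M" if "M \<in> C" for M
      using subset.chain_def[THEN iffD1, OF C] that by auto
    have tot: "M \<subseteq> N \<or> N \<subseteq> M" if "M \<in> C" "N \<in> C" for M N
      using subset.chain_total[OF C that] by blast
    have "pairwise r (\<Union>C)"
    proof (rule pairwiseI)
      fix x y assume "x \<in> \<Union>C" "y \<in> \<Union>C" and ne: "x \<noteq> y"
      then obtain M N where MN: "M \<in> C" "N \<in> C" "x \<in> M" "y \<in> N" by blast
      from tot[OF MN(1,2)] show "r x y"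
        using MN ne sub(2)[OF MN(1)] sub(2)[OF MN(2)] by (meson pairwiseD subsetD)
    qed
    then show "\<Union>C \<in> ?A" using sub(1) by blast
  qed
  then obtain M where "M \<in> ?A" and M3: "\<forall>Y\<in>?A. M \<subseteq> Y \<longrightarrow> Y = M" by (rule bexE)
  then have M: "M \<subseteq> X" "pairwise r M" by simp_all
  have "x \<in> M" if "x \<in> X" "\<forall>y\<in>M. r x y" for x
  proof -
    have "pairwise r (insert x M)"
      using M(2) that sym by (auto simp: pairwise_insert)
    then show ?thesis using M(1) M3[rule_format, of "insert x M"] that(1) by blast
  qed
  then show ?thesis using M by (intro exI[of _ M]) simp
qed

section \<open>Compact operators and their eigenspaces\<close>

definition cpt :: "('a::real_normed_vector \<Rightarrow>\<^sub>L 'b::real_normed_vector) \<Rightarrow> bool"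
  where "cpt Q \<longleftrightarrow> (\<exists>K. compact K \<and> Q ` cball 0 1 \<subseteq> K)"

lemma cptI: "compact K \<Longrightarrow> (\<And>x. norm x \<le> 1 \<Longrightarrow> blinfun_apply Q x \<in> K) \<Longrightarrow> cpt Q"
  unfolding cpt_def by (intro exI[of _ K]) auto

lemma cptE:
  assumes "cpt Q"
  obtains K where "compact K" "\<And>x. norm x \<le> 1 \<Longrightarrow> Q x \<in> K"
  using assms unfolding cpt_def by (auto simp: image_subset_iff)

lemma cpt_iff_compact_closure: "cpt Q \<longleftrightarrow> compact (closure (Q ` cball 0 1))"
proof
  assume "cpt Q"
  then obtain K where K: "compact K" "Q ` cball 0 1 \<subseteq> K" unfolding cpt_def by blast
  then have "K \<inter> closure (Q ` cball 0 1) = closure (Q ` cball 0 1)"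
    by (intro Int_absorb1 closure_minimal compact_imp_closed)
  then show "compact (closure (Q ` cball 0 1))"
    using compact_Int_closed[OF K(1) closed_closure, of "Q ` cball 0 1"] by simp
next
  assume "compact (closure (Q ` cball 0 1))"
  then show "cpt Q" unfolding cpt_def using closure_subset[of "Q ` cball 0 1"] by blast
qed

lemma cpt_add:
  assumes "cpt Q" "cpt R"
  shows "cpt (Q + R)"
proof -
  obtain K where K: "compact K" "\<And>x. norm x \<le> 1 \<Longrightarrow> Q x \<in> K"
    using cptE[OF assms(1)] by metis
  obtain L where L: "compact L" "\<And>x. norm x \<le> 1 \<Longrightarrow> R x \<in> L"
    using cptE[OF assms(2)] by metis
  show ?thesis
  proof (rule cptI[OF compact_sums[OF K(1) L(1)]])
    fix x :: 'a assume "norm x \<le> 1"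
    then have "(Q + R) x = Q x + R x" "Q x \<in> K" "R x \<in> L"
      using K(2) L(2) by (simp_all add: blinfun.add_left)
    then show "(Q + R) x \<in> {x + y |x y. x \<in> K \<and> y \<in> L}" by auto
  qed
qed

lemma cpt_compose_left:
  assumes "cpt Q"
  shows "cpt (T o\<^sub>L Q)"
proof -
  obtain K where K: "compact K" "\<And>x. norm x \<le> 1 \<Longrightarrow> Q x \<in> K"
    using cptE[OF assms] by metis
  have "compact (blinfun_apply T ` K)"
    by (intro compact_continuous_image K(1) continuous_intros)
  then show ?thesis by (rule cptI) (simp add: K(2))
qed

lemma cpt_scaleR:
  assumes "cpt Q"
  shows "cpt (r *\<^sub>R Q)"
proof -
  obtain K where K: "compact K" "\<And>x. norm x \<le> 1 \<Longrightarrow> Q x \<in> K"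
    using cptE[OF assms] by metis
  show ?thesis
    by (rule cptI[OF compact_scaling[OF K(1), of r]]) (unfold blinfun.scaleR_left, intro imageI K(2))
qed

lemma cpt_diff: "cpt Q \<Longrightarrow> cpt R \<Longrightarrow> cpt (Q - R)"
  using cpt_add[OF _ cpt_scaleR[of R "-1"], of Q] by simp

lemma cpt_compose_right:
  fixes T :: "'a::real_normed_vector \<Rightarrow>\<^sub>L 'b::real_normed_vector"
  assumes "cpt Q"
  shows "cpt (Q o\<^sub>L T)"
proof -
  obtain K where K: "compact K" "\<And>x. norm x \<le> 1 \<Longrightarrow> Q x \<in> K"
    using cptE[OF assms] by metis
  \<comment> \<open>The added 1 keeps the radius positive when \<open>T\<close> is zero, so that one
    can divide by it.\<close>
  let ?n = "norm T + 1"
  have n: "?n > 0" using norm_ge_zero[of T] by linarith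
  show ?thesis
  proof (rule cptI[OF compact_scaling[OF K(1), of ?n]])
    fix x :: 'a assume x: "norm x \<le> 1"
    have "norm (T x) \<le> norm T * norm x" by (rule norm_blinfun)
    also have "\<dots> \<le> norm T * 1" using x by (intro mult_left_mono) auto
    finally have "norm (T x) \<le> ?n" by linarith
    then have "norm (T x /\<^sub>R ?n) \<le> 1" using n by (simp add: divide_simps)
    then have "Q (T x /\<^sub>R ?n) \<in> K" by (rule K(2))
    moreover have "(Q o\<^sub>L T) x = ?n *\<^sub>R Q (T x /\<^sub>R ?n)"
      using n by (simp add: blinfun.scaleR_right)
    ultimately show "(Q o\<^sub>L T) x \<in> (*\<^sub>R) ?n ` K" by blast
  qed
qed

lemma ex_infinite_orthonormal:
  fixes N :: "'a::real_inner set"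
  assumes N: "subspace N" "inf_dim N"
  obtains s :: "nat \<Rightarrow> 'a" where "orthonormal_on UNIV s" "range s \<subseteq> N"
proof -
  let ?r = "\<lambda>x y::'a. inner x y = 0"
  obtain B where B: "B \<subseteq> {x\<in>N. norm x = 1}" "pairwise ?r B"
    "\<And>x. x \<in> N \<Longrightarrow> norm x = 1 \<Longrightarrow> (\<forall>y\<in>B. ?r x y) \<Longrightarrow> x \<in> B"
    using ex_maximal_pairwise[of ?r "{x\<in>N. norm x = 1}"] by (auto simp: inner_commute)
  have "infinite B"
  proof
    assume fin: "finite B"
    obtain x where x: "x \<in> N" "\<forall>y\<in>B. inner y x = 0" "x \<noteq> 0"
      using inf_dim_nonzero[OF inf_dim_orthogonal[OF fin N]] by blast
    have "x /\<^sub>R norm x \<in> B"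
      using x N(1) by (intro B(3)) (auto simp: inner_commute subspace_scale)
    with x(2) have "inner (x /\<^sub>R norm x) x = 0" by blast
    then show False using x(3) by simp
  qed
  then obtain s :: "nat \<Rightarrow> 'a" where s: "inj s" "range s \<subseteq> B"
    using infinite_countable_subset by blast
  have "orthonormal_on UNIV s"
    unfolding orthonormal_on_def
  proof (intro ballI)
    fix i j :: nat
    show "inner (s i) (s j) = (if i = j then 1 else 0)"
    proof (cases "i = j")
      case True
      have "norm (s j) = 1" using s(2) B(1) by auto
      then show ?thesis using True by (simp add: norm_eq_1)
    next
      case False
      then have "s i \<noteq> s j" using s(1) by (auto dest: injD)
      then show ?thesis using False s(2) pairwiseD[OF B(2), of "s i" "s j"] by auto
    qed
  qed
  then show ?thesis using that s(2) B(1) by blast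
qed

text \<open>The images of an orthonormal sequence of eigenvectors keep the mutual distance
  \<bar>c\<bar> times the square root of 2, so no subsequence of them converges. The cruder bound
  \<bar>c\<bar> is enough.\<close>

lemma cpt_no_inf_dim_eigenspace:
  fixes Q :: "'a::real_inner \<Rightarrow>\<^sub>L 'a"
  assumes Q: "cpt Q" and N: "subspace N" "inf_dim N" and c: "c \<noteq> 0"
    and eig: "\<And>x. x \<in> N \<Longrightarrow> Q x = c *\<^sub>R x"
  shows False
proof -
  obtain s :: "nat \<Rightarrow> 'a" where s: "orthonormal_on UNIV s" "range s \<subseteq> N"
    using ex_infinite_orthonormal[OF N] by blast
  have s1: "norm (s n) = 1" for n
    using orthonormal_onD[OF s(1), of n n] by (simp add: norm_eq_1)
  obtain K where K: "compact K" "Q ` cball 0 1 \<subseteq> K" using Q unfolding cpt_def by blast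
  have QK: "Q (s n) \<in> K" for n using K(2) s1 by (auto simp: image_subset_iff)
  then obtain l r where r: "strict_mono r" "((\<lambda>n. Q (s n)) \<circ> r) \<longlonglongrightarrow> l"
    using seq_compactE[OF compact_imp_seq_compact[OF K(1)], of "\<lambda>n. Q (s n)"] QK by metis
  have "Cauchy ((\<lambda>n. Q (s n)) \<circ> r)" using r(2) LIMSEQ_imp_Cauchy by blast
  moreover have "0 < \<bar>c\<bar>" using c by simp
  ultimately obtain M where M: "dist (Q (s (r m))) (Q (s (r n))) < \<bar>c\<bar>" if "m \<ge> M" "n \<ge> M" for m n
    unfolding Cauchy_def comp_apply by blast
  let ?x = "s (r M)" and ?y = "s (r (Suc M))"
  have ne: "r M \<noteq> r (Suc M)" using strict_monoD[OF r(1), of M "Suc M"] by simp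
  have "inner ?x ?x = 1" "inner ?y ?y = 1" "inner ?x ?y = 0" "inner ?y ?x = 0"
    using ne orthonormal_onD[OF s(1) UNIV_I UNIV_I] by presburger+
  then have "(norm (?x - ?y))\<^sup>2 = 2"
    unfolding power2_norm_eq_inner inner_diff_left inner_diff_right by linarith
  then have "1 \<le> norm (?x - ?y)" using power2_le_imp_le[of 1 "norm (?x - ?y)"] by simp
  then have "\<bar>c\<bar> * 1 \<le> \<bar>c\<bar> * norm (?x - ?y)" by (rule mult_left_mono) simp
  moreover have "dist (Q ?x) (Q ?y) = \<bar>c\<bar> * norm (?x - ?y)"
  proof -
    have "Q ?x - Q ?y = c *\<^sub>R (?x - ?y)"
      using eig s(2) by (simp add: range_subsetD scaleR_diff_right)
    then show ?thesis by (simp only: dist_norm norm_scaleR)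
  qed
  moreover have "dist (Q ?x) (Q ?y) < \<bar>c\<bar>" by (rule M) auto
  ultimately show False by linarith
qed

section \<open>Square roots close to the identity\<close>

definition commutes :: "('a::{real_inner,banach} \<Rightarrow>\<^sub>L 'a) \<Rightarrow> ('a \<Rightarrow>\<^sub>L 'a) \<Rightarrow> bool"
  where "commutes A B \<longleftrightarrow> (\<forall>x. A (B x) = B (A x))"

lemma commutesD: "commutes A B \<Longrightarrow> A (B x) = B (A x)"
  by (simp add: commutes_def)

text \<open>The self-adjoint part of the bicommutant of \<open>X\<close>, which stands in for a
  functional calculus. It is norm closed and stable under sums and products, so fixed point
  iterations can be run inside it, and whatever commutes with \<open>X\<close> commutes with the
  limit.\<close>

definition bicommutant :: "('a::{real_inner,banach} \<Rightarrow>\<^sub>L 'a) \<Rightarrow> ('a \<Rightarrow>\<^sub>L 'a) set"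
  where "bicommutant X = {T. selfadjoint T \<and> (\<forall>Q. commutes Q X \<longrightarrow> commutes Q T)}"

lemma bicommutantD:
  assumes "T \<in> bicommutant X"
  shows "selfadjoint T" "commutes Q X \<Longrightarrow> commutes Q T"
  using assms by (auto simp: bicommutant_def)

text \<open>\<open>X\<close> commutes with itself, hence with \<open>T\<close>; so \<open>T\<close>
  is one of the operators with which \<open>S\<close> has to commute.\<close>

lemma bicommutant_commute: "S \<in> bicommutant X \<Longrightarrow> T \<in> bicommutant X \<Longrightarrow> commutes S T"
  by (metis bicommutantD(2) commutes_def)

lemma bicommutant_self: "selfadjoint X \<Longrightarrow> X \<in> bicommutant X"
  by (simp add: bicommutant_def)

lemma bicommutant_id: "id_blinfun \<in> bicommutant X"
  by (simp add: bicommutant_def selfadjoint_def commutes_def)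

lemma bicommutant_add: "S \<in> bicommutant X \<Longrightarrow> T \<in> bicommutant X \<Longrightarrow> S + T \<in> bicommutant X"
  by (simp add: bicommutant_def selfadjoint_def commutes_def blinfun.add_left blinfun.add_right
      inner_add_left inner_add_right)

lemma bicommutant_scaleR: "T \<in> bicommutant X \<Longrightarrow> r *\<^sub>R T \<in> bicommutant X"
  by (simp add: bicommutant_def selfadjoint_def commutes_def blinfun.scaleR_left blinfun.scaleR_right)

lemma bicommutant_diff: "S \<in> bicommutant X \<Longrightarrow> T \<in> bicommutant X \<Longrightarrow> S - T \<in> bicommutant X"
  using bicommutant_add[OF _ bicommutant_scaleR[of T X "-1"], of S] by simp

lemma bicommutant_compose:
  assumes "S \<in> bicommutant X" "T \<in> bicommutant X"
  shows "S o\<^sub>L T \<in> bicommutant X"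
proof -
  have "inner (S (T x)) y = inner x (S (T y))" for x y
    using selfadjointD[OF bicommutantD(1)[OF assms(1)]] selfadjointD[OF bicommutantD(1)[OF assms(2)]]
      commutesD[OF bicommutant_commute[OF assms]] by simp
  then have "selfadjoint (S o\<^sub>L T)" by (simp add: selfadjoint_def)
  moreover have "commutes Q (S o\<^sub>L T)" if "commutes Q X" for Q
    using bicommutantD(2)[OF assms(1) that] bicommutantD(2)[OF assms(2) that]
    by (simp add: commutes_def)
  ultimately show ?thesis by (simp add: bicommutant_def)
qed

lemma closed_bicommutant: "closed (bicommutant X)"
proof -
  have "bicommutant X = (\<Inter>x y. {T. inner (blinfun_apply T x) y = inner x (blinfun_apply T y)}) \<inter>
      (\<Inter>Q\<in>{Q. commutes Q X}. \<Inter>x. {T. blinfun_apply Q (blinfun_apply T x) = blinfun_apply T (blinfun_apply Q x)})"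
    by (auto simp: bicommutant_def selfadjoint_def commutes_def)
  also have "closed \<dots>"
    by (intro closed_Int closed_INT ballI closed_Collect_eq continuous_intros)
  finally show ?thesis .
qed

lemma norm_compose_le:
  fixes A B :: "'a::real_normed_vector \<Rightarrow>\<^sub>L 'a"
  shows "norm A \<le> a \<Longrightarrow> norm B \<le> b \<Longrightarrow> norm (A o\<^sub>L B) \<le> a * b"
  by (rule order_trans[OF norm_blinfun_compose]) (auto intro: mult_mono order_trans[OF norm_ge_zero])

text \<open>Squaring has Lipschitz constant 2 on the unit ball. The factor 1/2 in the fixed point
  equation below cancels it, leaving a bound for the norm of \<open>X\<close> as the contraction
  constant.\<close>

lemma norm_square_diff_le:
  fixes Y Z :: "'a::real_normed_vector \<Rightarrow>\<^sub>L 'a"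
  assumes "norm Y \<le> 1" "norm Z \<le> 1"
  shows "norm ((Y o\<^sub>L Y) - (Z o\<^sub>L Z)) \<le> 2 * norm (Y - Z)"
proof -
  have "(Y o\<^sub>L Y) - (Z o\<^sub>L Z) = (Y o\<^sub>L (Y - Z)) + ((Y - Z) o\<^sub>L Z)"
    by (rule blinfun_eqI) (simp add: blinfun.diff_left blinfun.diff_right blinfun.add_left)
  then have "norm ((Y o\<^sub>L Y) - (Z o\<^sub>L Z)) \<le> norm (Y o\<^sub>L (Y - Z)) + norm ((Y - Z) o\<^sub>L Z)"
    using norm_triangle_ineq by metis
  also have "\<dots> \<le> 1 * norm (Y - Z) + norm (Y - Z) * 1"
    using assms by (intro add_mono norm_compose_le) auto
  finally show ?thesis by simp
qed

text \<open>
  The fixed point \<open>Z = (1 + r X Z\<^sup>2) / 2\<close> is \<open>(1 - sqrt (1 - r X)) / (r X)\<close>. Dividing by \<open>r X\<close> turns the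
  usual square root iteration into a contraction of the whole unit ball, and makes
  \<open>sqrt (1 - r X) - 1 = - r X Z\<close> visibly compact when \<open>X\<close> is.
\<close>

lemma sqrt_fixpoint:
  fixes X :: "'a::{real_inner,banach} \<Rightarrow>\<^sub>L 'a"
  assumes X: "selfadjoint X" "norm X \<le> q" "q < 1" and r: "r \<in> {0..1}"
  shows "\<exists>Z\<in>bicommutant X. norm Z \<le> 1 \<and> Z = (1/2) *\<^sub>R (id_blinfun + r *\<^sub>R (X o\<^sub>L (Z o\<^sub>L Z)))"
proof -
  have q: "0 \<le> q" using X(2) norm_ge_zero order_trans by blast
  let ?S = "bicommutant X \<inter> cball 0 1"
  let ?f = "\<lambda>Z. (1/2) *\<^sub>R (id_blinfun + r *\<^sub>R (X o\<^sub>L (Z o\<^sub>L Z)))"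
  have "\<exists>!Z. Z \<in> ?S \<and> ?f Z = Z"
  proof (rule Banach_fix[of ?S q])
    show "complete ?S"
      unfolding complete_eq_closed by (intro closed_Int closed_bicommutant closed_cball)
    show "?S \<noteq> {}" using bicommutant_id norm_blinfun_id_le by fastforce
    show "?f ` ?S \<subseteq> ?S"
    proof clarify
      fix Z assume Z: "Z \<in> bicommutant X" "Z \<in> cball 0 1"
      have "norm (X o\<^sub>L (Z o\<^sub>L Z)) \<le> q * (1 * 1)"
        using X(2) Z(2) by (intro norm_compose_le) auto
      then have "norm (r *\<^sub>R (X o\<^sub>L (Z o\<^sub>L Z))) \<le> 1 * 1"
        unfolding norm_scaleR using r X(3) by (intro mult_mono) auto
      then have "norm (id_blinfun + r *\<^sub>R (X o\<^sub>L (Z o\<^sub>L Z)) :: 'a \<Rightarrow>\<^sub>L 'a) \<le> 1 + 1"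
        by (intro norm_triangle_le add_mono norm_blinfun_id_le) auto
      then show "?f Z \<in> ?S"
        using Z X(1) by (auto intro!: bicommutant_scaleR bicommutant_add bicommutant_id
            bicommutant_compose bicommutant_self)
    qed
    show "dist (?f Z) (?f Y) \<le> q * dist Z Y" if "Z \<in> ?S" "Y \<in> ?S" for Z Y
    proof -
      have "?f Z - ?f Y = (r / 2) *\<^sub>R (X o\<^sub>L ((Z o\<^sub>L Z) - (Y o\<^sub>L Y)))"
        by (rule blinfun_eqI)
          (simp add: blinfun.bilinear_simps algebra_simps)
      then have "dist (?f Z) (?f Y) = (r / 2) * norm (X o\<^sub>L ((Z o\<^sub>L Z) - (Y o\<^sub>L Y)))"
        using r by (simp add: dist_norm)
      also have "\<dots> \<le> (1 / 2) * (q * (2 * norm (Z - Y)))"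
        using r q X(2) that by (intro mult_mono norm_compose_le norm_square_diff_le) auto
      finally show ?thesis by (simp add: dist_norm)
    qed
  qed (use q X(3) in auto)
  then obtain Z where "Z \<in> ?S" "?f Z = Z" by blast
  then show ?thesis by (intro bexI[of _ Z]) auto
qed

text \<open>The fixed point is the inverse of \<open>id_blinfun - Y\<close>. Running the iteration
  inside the closed set \<open>bicommutant X\<close> yields membership together with
  existence.\<close>

lemma neumann_inverse:
  fixes X Y :: "'a::{real_inner,banach} \<Rightarrow>\<^sub>L 'a"
  assumes Y: "Y \<in> bicommutant X" "norm Y \<le> q" "q < 1"
  shows "\<exists>T\<in>bicommutant X. T = id_blinfun + (Y o\<^sub>L T)"
proof -
  have q: "0 \<le> q" using Y(2) norm_ge_zero order_trans by blast
  have "\<exists>!T. T \<in> bicommutant X \<and> id_blinfun + (Y o\<^sub>L T) = T"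
  proof (rule Banach_fix[of "bicommutant X" q])
    show "complete (bicommutant X)" by (simp add: complete_eq_closed closed_bicommutant)
    show "bicommutant X \<noteq> {}" using bicommutant_id by blast
    show "(\<lambda>T. id_blinfun + (Y o\<^sub>L T)) ` bicommutant X \<subseteq> bicommutant X"
      using Y(1) by (auto intro!: bicommutant_add bicommutant_id bicommutant_compose)
    show "dist (id_blinfun + (Y o\<^sub>L S)) (id_blinfun + (Y o\<^sub>L T)) \<le> q * dist S T" for S T
    proof -
      have "(id_blinfun + (Y o\<^sub>L S)) - (id_blinfun + (Y o\<^sub>L T)) = Y o\<^sub>L (S - T)"
        by (rule blinfun_eqI) (simp add: blinfun.bilinear_simps)
      then show ?thesis using Y(2) by (simp add: dist_norm norm_compose_le)
    qed
  qed (use q Y(3) in auto)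
  then show ?thesis by (metis (no_types, lifting))
qed

text \<open>\<open>S r\<close> is the square root of 1 - r X, given by 1 - r X Z with Z the fixed
  point for r, and \<open>T\<close> is the inverse of \<open>S 1\<close>. Both differ from the
  identity by \<open>X\<close> times a bounded operator, which is why compactness of
  \<open>X\<close> passes to the differences.\<close>

lemma sqrt_family:
  fixes X :: "'a::{real_inner,banach} \<Rightarrow>\<^sub>L 'a"
  assumes X: "selfadjoint X" "norm X \<le> q" "q < 1"
  obtains S :: "real \<Rightarrow> 'a \<Rightarrow>\<^sub>L 'a" and T :: "'a \<Rightarrow>\<^sub>L 'a"
  where "continuous_on {0..1} S" "S 0 = id_blinfun"
    "\<And>r. r \<in> {0..1} \<Longrightarrow> S r \<in> bicommutant X"
    "\<And>r x. r \<in> {0..1} \<Longrightarrow> S r (S r x) = x - r *\<^sub>R X x"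
    "\<And>r x. r \<in> {0..1} \<Longrightarrow> X x = 0 \<Longrightarrow> S r x = x"
    "\<And>r. r \<in> {0..1} \<Longrightarrow> cpt X \<Longrightarrow> cpt (S r - id_blinfun)"
    "T \<in> bicommutant X" "\<And>x. S 1 (T x) = x" "cpt X \<Longrightarrow> cpt (T - id_blinfun)"
proof -
  obtain Z where Z: "\<And>r. r \<in> {0..1} \<Longrightarrow> Z r \<in> bicommutant X"
    "\<And>r. r \<in> {0..1} \<Longrightarrow> norm (Z r) \<le> 1"
    and Zeq: "\<And>r. r \<in> {0..1} \<Longrightarrow> Z r = (1/2) *\<^sub>R (id_blinfun + r *\<^sub>R (X o\<^sub>L (Z r o\<^sub>L Z r)))"
    using sqrt_fixpoint[OF X] by metis
  have q: "0 \<le> q" using X(2) norm_ge_zero order_trans by blast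
  have XZ: "X (Z r x) = Z r (X x)" if "r \<in> {0..1}" for r x
    using bicommutant_commute[OF bicommutant_self[OF X(1)] Z(1)[OF that]] by (simp add: commutes_def)
  \<comment> \<open>The fixed point equation solved for its quadratic term. Inserted into (1 - r X
    Z)^2, it turns r^2 X^2 Z^2 into r X (2 Z - 1), and only 1 - r X remains.\<close>
  have ZZ: "r *\<^sub>R X (Z r (Z r x)) = 2 *\<^sub>R Z r x - x" if "r \<in> {0..1}" for r x
  proof -
    have "Z r x = ((1/2) *\<^sub>R (id_blinfun + r *\<^sub>R (X o\<^sub>L (Z r o\<^sub>L Z r)))) x"
      using Zeq[OF that] by simp
    also have "\<dots> = (1/2) *\<^sub>R (x + r *\<^sub>R X (Z r (Z r x)))"
      by (simp add: blinfun.bilinear_simps)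
    finally have "2 *\<^sub>R Z r x = x + r *\<^sub>R X (Z r (Z r x))"
      by (metis scaleR_half_double scaleR_2 scaleR_right_distrib)
    then show ?thesis by simp
  qed
  \<comment> \<open>Subtracting the equations for \<open>r\<close> and \<open>s\<close> leaves a
    term bounded by \<open>q * norm (Z r - Z s)\<close>, which is absorbed on the left because
    \<open>q < 1\<close>.\<close>
  have lip: "norm (Z r - Z s) \<le> q / (2 * (1 - q)) * norm (r - s)"
    if r: "r \<in> {0..1}" and s: "s \<in> {0..1}" for r s
  proof -
    have "Z r - Z s = (1/2) *\<^sub>R (r *\<^sub>R (X o\<^sub>L ((Z r o\<^sub>L Z r) - (Z s o\<^sub>L Z s)))
        + (r - s) *\<^sub>R (X o\<^sub>L (Z s o\<^sub>L Z s)))" (is "_ = (1/2) *\<^sub>R (?A + ?B)")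
      by (subst Zeq[OF r], subst Zeq[OF s], rule blinfun_eqI)
        (simp add: blinfun.bilinear_simps algebra_simps)
    then have "norm (Z r - Z s) = (1/2) * norm (?A + ?B)"
      by (metis abs_of_nonneg norm_scaleR zero_le_divide_1_iff zero_le_numeral)
    also have "\<dots> \<le> (1/2) * (norm ?A + norm ?B)"
      by (intro mult_left_mono norm_triangle_ineq) auto
    also have "norm ?A \<le> 1 * (q * (2 * norm (Z r - Z s)))"
      unfolding norm_scaleR using r s q X(2) Z
      by (intro mult_mono norm_compose_le norm_square_diff_le) auto
    also have "norm ?B \<le> norm (r - s) * (q * (1 * 1))"
      unfolding norm_scaleR using r s q X(2) Z
      by (intro mult_mono norm_compose_le) auto
    finally have "(1 - q) * norm (Z r - Z s) \<le> q * norm (r - s) / 2"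
      by (simp add: algebra_simps)
    then show ?thesis using X(3) by (simp add: field_simps)
  qed
  have contZ: "continuous_on {0..1} Z"
  proof (rule lipschitz_on_continuous_on)
    show "(q / (2 * (1 - q)))-lipschitz_on {0..1} Z"
      using lip q X(3) by (intro lipschitz_onI) (auto simp: dist_norm)
  qed
  define S where "S r = id_blinfun - r *\<^sub>R (X o\<^sub>L Z r)" for r
  have Y: "X o\<^sub>L Z 1 \<in> bicommutant X"
    using Z(1)[of 1] X(1) by (auto intro: bicommutant_compose bicommutant_self)
  have "norm (X o\<^sub>L Z 1) \<le> q * 1"
    using X(2) Z(2)[of 1] by (intro norm_compose_le) auto
  then obtain T where T: "T \<in> bicommutant X" "T = id_blinfun + ((X o\<^sub>L Z 1) o\<^sub>L T)"
    using neumann_inverse[OF Y _ X(3)] by auto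
  have Tx: "T x = x + X (Z 1 (T x))" for x
    by (subst T(2)) (simp add: blinfun.bilinear_simps)
  show ?thesis
  proof (rule that[of S T])
    show "continuous_on {0..1} S"
      unfolding S_def by (intro continuous_intros contZ)
    show "S 0 = id_blinfun" by (simp add: S_def)
    show "S r \<in> bicommutant X" if "r \<in> {0..1}" for r
      unfolding S_def using Z(1)[OF that] X(1)
      by (intro bicommutant_diff bicommutant_id bicommutant_scaleR bicommutant_compose bicommutant_self)
    show "S r (S r x) = x - r *\<^sub>R X x" if "r \<in> {0..1}" for r x
    proof -
      have "S r (S r x) = x - r *\<^sub>R X (Z r x) - r *\<^sub>R X (Z r x) + r *\<^sub>R X (r *\<^sub>R X (Z r (Z r x)))"
        by (simp add: S_def blinfun.bilinear_simps XZ[OF that] scaleR_diff_right)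
      also have "\<dots> = x - r *\<^sub>R X x"
        unfolding ZZ[OF that]
        by (simp add: blinfun.bilinear_simps XZ[OF that] scaleR_2 scaleR_diff_right scaleR_add_right)
      finally show ?thesis .
    qed
    show "S r x = x" if "r \<in> {0..1}" "X x = 0" for r x
      using that by (simp add: S_def blinfun.bilinear_simps XZ[OF that(1)])
    show "cpt (S r - id_blinfun)" if "r \<in> {0..1}" "cpt X" for r
      using cpt_scaleR[OF cpt_compose_right[OF that(2)], of "-r" "Z r"] by (simp add: S_def)
    show "T \<in> bicommutant X" by (rule T(1))
    show "S 1 (T x) = x" for x
      using Tx[of x] by (simp add: S_def blinfun.bilinear_simps) (metis add_diff_cancel_right')
    show "cpt (T - id_blinfun)" if "cpt X"
    proof -
      have "T - id_blinfun = X o\<^sub>L (Z 1 o\<^sub>L T)"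
        by (rule blinfun_eqI) (use Tx in \<open>simp add: blinfun.bilinear_simps\<close>, metis add_diff_cancel_left')
      then show ?thesis using cpt_compose_right[OF that] by simp
    qed
  qed
qed

section \<open>Deformation of a self-adjoint unitary to one commuting with a projection\<close>

lemma path_componentI:
  fixes g :: "real \<Rightarrow> 'a::topological_space"
  assumes "continuous_on {0..1} g" "\<And>t. t \<in> {0..1} \<Longrightarrow> g t \<in> S" "g 0 = x" "g 1 = y"
  shows "path_component S x y"
  using assms
  unfolding path_component_def path_def pathstart_def pathfinish_def path_image_def
  by (intro exI[of _ g]) auto

text \<open>The real adjoint of \<open>g\<close> is a multiple of \<open>g\<close>: the factor is 1
  for self-adjoint operators and for C, and -1 for multiplication by \<i> and for J. Hence
  \<open>g\<close> preserves the orthogonal complement of any subspace that it preserves.\<close>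

definition pm_symmetric :: "('a::{real_inner,banach} \<Rightarrow>\<^sub>L 'a) \<Rightarrow> bool"
  where "pm_symmetric g \<longleftrightarrow> (\<exists>d. \<forall>x y. inner (g x) y = d * inner x (g y))"

text \<open>The projection is the sum over a maximal orthonormal subset of \<open>E\<close>, indexed
  by itself. If it moved some \<open>x\<close> of \<open>E\<close>, the normalized difference would
  be a further member of that subset.\<close>

lemma ex_projection:
  fixes E :: "'a::{real_inner,banach} set"
  assumes E: "closed E" "subspace E"
  obtains p where "is_proj p" "\<And>x. x \<in> E \<longleftrightarrow> p x = x"
proof -
  let ?r = "\<lambda>x y::'a. inner x y = 0"
  obtain B where B: "B \<subseteq> {x\<in>E. norm x = 1}" "pairwise ?r B"
    "\<And>x. x \<in> E \<Longrightarrow> norm x = 1 \<Longrightarrow> (\<forall>y\<in>B. ?r x y) \<Longrightarrow> x \<in> B"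
    using ex_maximal_pairwise[of ?r "{x\<in>E. norm x = 1}"] by (auto simp: inner_commute)
  have b: "orthonormal_on B id"
    unfolding orthonormal_on_def
  proof (intro ballI)
    fix x y assume xy: "x \<in> B" "y \<in> B"
    then have "norm x = 1" using B(1) by blast
    then show "inner (id x) (id y) = (if x = y then 1 else 0)"
      using xy pairwiseD[OF B(2) xy] by (auto simp: norm_eq_1)
  qed
  let ?p = "shift_op B id id :: 'a \<Rightarrow>\<^sub>L 'a"
  have pE: "?p x \<in> E" for x
    by (rule shift_op_closed[OF b b E]) (use B(1) in auto)
  have "?p x = x" if x: "x \<in> E" for x
  proof (rule ccontr)
    assume ne: "?p x \<noteq> x"
    let ?y = "x - ?p x"
    have y: "?y \<in> E" using E(2) x pE subspace_diff by blast
    have orth: "inner e ?y = 0" if "e \<in> B" for e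
      using inner_shift_op_basis[OF b b that, of x] by (simp add: inner_diff_right)
    have "?y /\<^sub>R norm ?y \<in> B"
      by (rule B(3)) (use ne y E(2) orth in \<open>auto simp: subspace_scale inner_commute\<close>)
    from orth[OF this] ne show False by simp
  qed
  then show ?thesis using that[of ?p] is_proj_shift_op[OF b] pE by metis
qed

text \<open>\<open>g\<close> preserves the range of \<open>p\<close> by assumption and the kernel of
  \<open>p\<close> by symmetry up to a factor.\<close>

lemma is_proj_commutes:
  assumes p: "is_proj p" and g: "pm_symmetric g" and inv: "\<And>x. p x = x \<Longrightarrow> p (g x) = g x"
  shows "commutes p g"
  unfolding commutes_def
proof
  fix x
  obtain d where d: "\<And>x y. inner (g x) y = d * inner x (g y)"
    using g unfolding pm_symmetric_def by blast
  let ?y = "x - p x"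
  have orth: "inner ?y (p w) = 0" for w
    by (simp add: is_projD(1)[OF p] blinfun.diff_right flip: is_projD(2)[OF p])
  have "inner (p (g ?y)) (p (g ?y)) = d * inner ?y (g (p (g ?y)))"
    by (simp add: is_projD[OF p] d)
  also have "g (p (g ?y)) = p (g (p (g ?y)))"
    using inv[of "p (g ?y)"] is_projD(1)[OF p] by simp
  also have "inner ?y \<dots> = 0" by (rule orth)
  finally have "p (g ?y) = 0" by simp
  then show "p (g x) = g (p x)"
    using inv[of "p x"] is_projD(1)[OF p] by (simp add: blinfun.diff_right)
qed

text \<open>Without a gap, there are unit vectors in the kernel of \<open>p\<close> with
  \<open>norm (K y)\<close> tending to 1. They are almost fixed by K^2, so by compactness a
  subsequence converges to a unit vector fixed by K^2. The limit lies both in the range and in the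
  kernel of \<open>p\<close>.\<close>

lemma cpt_spectral_gap:
  fixes K :: "'a::{real_inner,banach} \<Rightarrow>\<^sub>L 'a"
  assumes K: "selfadjoint K" "cpt K" and le: "\<And>x. norm (K x) \<le> norm x"
    and p: "is_proj p" and fix_p: "\<And>x. K (K x) = x \<Longrightarrow> p x = x"
  obtains q where "0 \<le> q" "q < 1" "\<And>x. p x = 0 \<Longrightarrow> norm (K x) \<le> q * norm x"
proof (rule ccontr)
  note gap = that
  assume neg: "\<not> thesis"
  \<comment> \<open>Each number 1 - 1/(n + 2) is a candidate for \<open>q\<close>, and a normalized
    vector violating the bound is taken.\<close>
  have "\<exists>y. p y = 0 \<and> norm y = 1 \<and> norm (K y) > 1 - 1 / real (n + 2)" for n
  proof -
    have "0 \<le> 1 - 1 / real (n + 2)" "1 - 1 / real (n + 2) < 1" by auto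
    then obtain x where x: "p x = 0" "norm (K x) > (1 - 1 / real (n + 2)) * norm x"
      using neg gap by (meson not_le)
    then have "x \<noteq> 0" by auto
    then show ?thesis
      using x by (intro exI[of _ "x /\<^sub>R norm x"]) (simp add: blinfun.scaleR_right field_simps)
  qed
  then obtain y where y: "\<And>n. p (y n) = 0" "\<And>n. norm (y n) = 1"
    "\<And>n. norm (K (y n)) > 1 - 1 / real (n + 2)" by metis
  obtain C where C: "compact C" "\<And>x. norm x \<le> 1 \<Longrightarrow> K x \<in> C" using cptE[OF K(2)] by metis
  have KC: "K (y n) \<in> C" for n using C(2) y(2) by simp
  obtain l r where r: "strict_mono r" "((\<lambda>n. K (y n)) \<circ> r) \<longlonglongrightarrow> l"
    using seq_compactE[OF compact_imp_seq_compact[OF C(1)], of "\<lambda>n. K (y n)"] KC by metis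
  have lim: "(\<lambda>n. K (y (r n))) \<longlonglongrightarrow> l" using r(2) by (simp add: o_def)
  have sq: "(norm (K (K (y n)) - y n))\<^sup>2 \<le> 2 - 2 * (1 - 1 / real (n + 2))\<^sup>2" for n
  proof -
    have "(norm (K (K (y n)) - y n))\<^sup>2 = (norm (K (K (y n))))\<^sup>2 - 2 * (norm (K (y n)))\<^sup>2 + (norm (y n))\<^sup>2"
      by (simp add: power2_norm_eq_inner inner_diff_left inner_diff_right inner_commute
          selfadjointD[OF K(1)])
    moreover have "norm (K (K (y n))) \<le> 1"
      using le[of "K (y n)"] le[of "y n"] y(2)[of n] by linarith
    then have "(norm (K (K (y n))))\<^sup>2 \<le> 1" by (simp add: power_le_one)
    moreover have "(1 - 1 / real (n + 2))\<^sup>2 \<le> (norm (K (y n)))\<^sup>2"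
      using y(3)[of n] by (intro power_mono) auto
    moreover have "(norm (y n))\<^sup>2 = 1" using y(2)[of n] by simp
    ultimately show ?thesis by linarith
  qed
  have "(\<lambda>n. (norm (K (K (y n)) - y n))\<^sup>2) \<longlonglongrightarrow> 0"
  proof (rule tendsto_sandwich[OF _ _ tendsto_const])
    show "\<forall>\<^sub>F n in sequentially. 0 \<le> (norm (K (K (y n)) - y n))\<^sup>2" by simp
    show "\<forall>\<^sub>F n in sequentially. (norm (K (K (y n)) - y n))\<^sup>2 \<le> 2 - 2 * (1 - 1 / real (n + 2))\<^sup>2"
      using sq by simp
    have "(\<lambda>n. 1 / real (n + 2)) \<longlonglongrightarrow> 0"
      using LIMSEQ_ignore_initial_segment[OF lim_1_over_n, of 2] by simp
    then have "(\<lambda>n. 2 - 2 * (1 - 1 / real (n + 2))\<^sup>2) \<longlonglongrightarrow> 2 - 2 * (1 - 0)\<^sup>2"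
      by (intro tendsto_intros)
    then show "(\<lambda>n. 2 - 2 * (1 - 1 / real (n + 2))\<^sup>2) \<longlonglongrightarrow> 0" by simp
  qed
  then have "(\<lambda>n. sqrt ((norm (K (K (y n)) - y n))\<^sup>2)) \<longlonglongrightarrow> sqrt 0"
    by (rule tendsto_real_sqrt)
  then have "(\<lambda>n. K (K (y n)) - y n) \<longlonglongrightarrow> 0"
    by (simp add: tendsto_norm_zero_iff)
  then have d0: "(\<lambda>n. K (K (y (r n))) - y (r n)) \<longlonglongrightarrow> 0"
    using LIMSEQ_subseq_LIMSEQ[OF _ r(1)] by (fastforce simp: o_def)
  have "(\<lambda>n. K (K (y (r n))) - (K (K (y (r n))) - y (r n))) \<longlonglongrightarrow> K l - 0"
    by (intro tendsto_intros lim d0)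
  \<comment> \<open>The vectors \<open>y (r n)\<close> converge because their images under K^2 do
    and the difference tends to 0.\<close>
  then have ylim: "(\<lambda>n. y (r n)) \<longlonglongrightarrow> K l" by simp
  have "(\<lambda>n. K (K (y (r n))) - y (r n)) \<longlonglongrightarrow> K (K (K l)) - K l"
    by (intro tendsto_intros ylim)
  from LIMSEQ_unique[OF d0 this] have "p (K l) = K l" by (intro fix_p) simp
  moreover have "(\<lambda>n. p (y (r n))) \<longlonglongrightarrow> p (K l)" by (intro tendsto_intros ylim)
  then have "p (K l) = 0" using y(1) LIMSEQ_unique[OF tendsto_const] by fastforce
  moreover have "(\<lambda>n. norm (y (r n))) \<longlonglongrightarrow> norm (K l)" by (intro tendsto_intros ylim)
  then have "norm (K l) = 1" using y(2) LIMSEQ_unique[OF tendsto_const] by fastforce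
  ultimately show False by simp
qed

text \<open>Self-adjoint unitaries in the form of self-adjoint involutions; this form uses the real
  inner product only.\<close>

definition saus :: "('a::{real_inner,banach} \<Rightarrow>\<^sub>L 'a) set \<Rightarrow> ('a \<Rightarrow>\<^sub>L 'a) set"
  where "saus G = {U. selfadjoint U \<and> (\<forall>x. U (U x) = x) \<and> (\<forall>g\<in>G. commutes U g)}"

lemma sausI:
  fixes U :: "'a::{real_inner,banach} \<Rightarrow>\<^sub>L 'a"
  assumes "\<And>x z. inner (U x) z = inner x (U z)" "\<And>x. U (U x) = x"
    and "\<And>g x. g \<in> G \<Longrightarrow> U (blinfun_apply g x) = g (U x)"
  shows "U \<in> saus G"
  using assms by (simp add: saus_def selfadjoint_def commutes_def)

lemma sausD:
  assumes "U \<in> saus G"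
  shows "inner (U x) z = inner x (U z)" "U (U x) = x" "g \<in> G \<Longrightarrow> U (g x) = g (U x)"
  using assms by (auto simp: saus_def selfadjoint_def commutes_def)

text \<open>That the path runs through compact perturbations of \<open>U\<close> belongs to the
  conclusion: it lets one and the same comparison operator certify every point of the path.\<close>

lemma deform_to_commuting:
  fixes U L :: "'a::{real_inner,banach} \<Rightarrow>\<^sub>L 'a"
  assumes L: "is_proj L" and G: "\<And>g. g \<in> G \<Longrightarrow> pm_symmetric g" "\<And>g. g \<in> G \<Longrightarrow> commutes L g"
    and U: "U \<in> saus G" and comm: "cpt ((U o\<^sub>L L) - (L o\<^sub>L U))"
  obtains V where "V \<in> saus G" "commutes V L" "path_component {W \<in> saus G. cpt (W - U)} U V"
proof -
  note bl = blinfun.bilinear_simps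
  define y where "y = 2 *\<^sub>R L - id_blinfun"
  define A where "A = (1/2) *\<^sub>R (U + (y o\<^sub>L (U o\<^sub>L y)))"
  define K where "K = (1/2) *\<^sub>R (U - (y o\<^sub>L (U o\<^sub>L y)))"
  have yx: "y x = 2 *\<^sub>R L x - x" for x by (simp add: y_def bl)
  have yy: "y (y x) = x" for x
    by (simp add: yx bl is_projD(1)[OF L] scaleR_2)
  have ysa: "inner (y x) z = inner x (y z)" for x z
    by (simp add: yx is_projD(2)[OF L] inner_diff_left inner_diff_right)
  have Ax: "A x = (1/2) *\<^sub>R (U x + y (U (y x)))" for x by (simp add: A_def bl)
  have Kx: "K x = (1/2) *\<^sub>R (U x - y (U (y x)))" for x by (simp add: K_def bl)
  have Ux: "U x = A x + K x" for x
    unfolding Ax Kx by (simp add: algebra_simps flip: scaleR_add_left)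
  note UU = sausD(2)[OF U] and Usa = sausD(1)[OF U]
  have Asa: "inner (A x) z = inner x (A z)" and Ksa: "inner (K x) z = inner x (K z)" for x z
    by (simp_all add: Ax Kx inner_add_left inner_add_right inner_diff_left inner_diff_right ysa Usa)
  have KA: "K (A x) = - A (K x)" and AA: "A (A x) = x - K (K x)" for x
    by (simp_all add: Ax Kx bl UU yy algebra_simps flip: scaleR_add_left)
  have Ay: "A (y x) = y (A x)" and Ky: "K (y x) = - y (K x)" for x
    by (simp_all add: Ax Kx bl yy algebra_simps)
  have yg: "y (g x) = g (y x)" if "g \<in> G" for g x
    using commutesD[OF G(2)[OF that]] by (simp add: yx bl)
  have Ag: "A (g x) = g (A x)" and Kg: "K (g x) = g (K x)" if "g \<in> G" for g x
    by (simp_all add: Ax Kx bl yg[OF that] sausD(3)[OF U that])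
  have cK: "cpt K"
  proof -
    \<comment> \<open>Since y^2 = 1, K = (K y) y, and K y is half of U y - y U, which is the
      commutator of \<open>U\<close> with \<open>L\<close>.\<close>
    have "K = ((U o\<^sub>L L) - (L o\<^sub>L U)) o\<^sub>L y"
      by (rule blinfun_eqI)
        (simp add: Kx yx bl is_projD(1)[OF L] algebra_simps scaleR_2 flip: scaleR_add_left)
    then show ?thesis using cpt_compose_right[OF comm] by simp
  qed
  have Kle: "norm (K x) \<le> norm x" for x
  proof -
    have "(norm (K x))\<^sup>2 = (norm x)\<^sup>2 - (norm (A x))\<^sup>2"
      using Asa[of x "A x"] Ksa[of x "K x"]
      by (simp add: power2_norm_eq_inner AA inner_diff_right)
    then have "(norm (K x))\<^sup>2 \<le> (norm x)\<^sup>2" by simp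
    then show ?thesis by (rule power2_le_imp_le) simp
  qed
  have "closed {x. K (K x) = x}"
    by (intro closed_Collect_eq continuous_intros)
  moreover have "subspace {x. K (K x) = x}" by (simp add: subspace_def bl)
  ultimately obtain p where p: "is_proj p" and pE: "\<And>x. K (K x) = x \<longleftrightarrow> p x = x"
    by (rule ex_projection) simp
  note pp = is_projD(1)[OF p] and psa = is_projD(2)[OF p]
  have KKp: "K (K (p x)) = p x" for x using pE pp by blast
  have sa_pm: "pm_symmetric Q" if "\<And>x z. inner (blinfun_apply Q x) z = inner x (Q z)" for Q
    unfolding pm_symmetric_def using that by (intro exI[of _ 1]) simp
  have comm_p: "p (Q x) = Q (p x)" if "pm_symmetric Q" "\<And>x. K (K (Q x)) = Q (K (K x))" for Q x
  proof (rule commutesD, rule is_proj_commutes[OF p that(1)])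
    show "p (Q x) = Q x" if "p x = x" for x
      using \<open>\<And>x. K (K (Q x)) = Q (K (K x))\<close>[of x] pE that by metis
  qed
  have pK: "p (K x) = K (p x)" for x by (rule comm_p) (simp_all add: sa_pm Ksa)
  have pA': "p (A x) = A (p x)" for x by (rule comm_p) (simp_all add: sa_pm Asa KA bl)
  have py: "p (y x) = y (p x)" for x by (rule comm_p) (simp_all add: sa_pm ysa Ky bl)
  have pg: "p (g x) = g (p x)" if "g \<in> G" for g x
    by (rule comm_p) (simp_all add: G(1)[OF that] Kg[OF that])
  \<comment> \<open>The square of the norm of A (p x) is the inner product of p x with (1 - K^2) p
    x, which is 0.\<close>
  have Ap: "A (p x) = 0" for x
  proof -
    have "inner (A (p x)) (A (p x)) = 0" by (simp add: Asa AA KKp)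
    then show ?thesis by simp
  qed
  have pA: "p (A x) = 0" for x by (simp add: pA' Ap)
  have AKp: "A (K (p x)) = 0" for x using KA[of "p x"] by (simp add: Ap bl)
  \<comment> \<open>K^2 has norm 1 as soon as \<open>p\<close> is nonzero. Subtracting
    \<open>p\<close> removes its eigenvalue 1, so the norm drops below 1, and 1 - X = A^2 + p has an
    invertible square root.\<close>
  define X where "X = (K o\<^sub>L K) - p"
  have Xx: "X x = K (K x) - p x" for x by (simp add: X_def bl)
  have cp: "cpt p"
  proof -
    have "p = K o\<^sub>L (K o\<^sub>L p)" by (rule blinfun_eqI) (simp add: KKp)
    then show ?thesis using cpt_compose_right[OF cK, of "K o\<^sub>L p"] by simp
  qed
  have cX: "cpt X" unfolding X_def by (intro cpt_diff cp cpt_compose_right cK)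
  have Xsa: "selfadjoint X"
    by (simp add: selfadjoint_def Xx inner_diff_left inner_diff_right Ksa psa)
  obtain q where q: "0 \<le> q" "q < 1" "\<And>x. p x = 0 \<Longrightarrow> norm (K x) \<le> q * norm x"
    using cpt_spectral_gap[of K p] Ksa cK Kle p pE by (metis selfadjoint_def)
  have Xq: "norm X \<le> q"
  proof (rule norm_blinfun_bound[OF q(1)])
    fix x
    let ?z = "x - p x"
    have "(norm ?z)\<^sup>2 = (norm x)\<^sup>2 - (norm (p x))\<^sup>2"
      using psa[of x x] psa[of x "p x"]
      by (simp add: power2_norm_eq_inner inner_diff_left inner_diff_right inner_commute pp)
    then have "(norm ?z)\<^sup>2 \<le> (norm x)\<^sup>2" by simp
    then have z: "norm ?z \<le> norm x" by (rule power2_le_imp_le) simp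
    have "X x = K (K ?z)" by (simp add: Xx bl KKp)
    then have "norm (X x) \<le> norm (K ?z)" using Kle by simp
    also have "\<dots> \<le> q * norm ?z" by (rule q(3)) (simp add: bl pp)
    also have "\<dots> \<le> q * norm x" using z q(1) by (rule mult_left_mono)
    finally show "norm (X x) \<le> q * norm x" .
  qed
  obtain S T where contS: "continuous_on {0..1} S" and S0: "S 0 = id_blinfun"
    and Sb: "\<And>r. r \<in> {0..1} \<Longrightarrow> S r \<in> bicommutant X"
    and SS: "\<And>r x. r \<in> {0..1} \<Longrightarrow> S r (S r x) = x - r *\<^sub>R X x"
    and Sfix: "\<And>r x. r \<in> {0..1} \<Longrightarrow> X x = 0 \<Longrightarrow> S r x = x"
    and Scpt: "\<And>r. r \<in> {0..1} \<Longrightarrow> cpt X \<Longrightarrow> cpt (S r - id_blinfun)"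
    and Tb: "T \<in> bicommutant X" and ST: "\<And>x. S 1 (T x) = x" and Tcpt: "cpt X \<Longrightarrow> cpt (T - id_blinfun)"
    by (rule sqrt_family[OF Xsa Xq q(2)]) (rule that; assumption)
  \<comment> \<open>K, y, p and every g in G commute with \<open>X\<close>, and so does A, because
    it anticommutes with K and vanishes on the range of \<open>p\<close>. All of them then commute
    with \<open>S r\<close> and \<open>T\<close>.\<close>
  have com: "R (Q x) = Q (R x)"
    if "R \<in> bicommutant X" "\<And>x. X (blinfun_apply Q x) = Q (X x)" for R Q x
    using bicommutantD(2)[OF that(1), of Q] that(2) by (simp add: commutes_def)
  have RA: "R (A x) = A (R x)" and RK: "R (K x) = K (R x)" and Ry: "R (y x) = y (R x)"
    and Rp: "R (p x) = p (R x)" and Rg: "g \<in> G \<Longrightarrow> R (g x) = g (R x)"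
    and Rsa: "inner (R x) z = inner x (R z)"
    if R: "R \<in> bicommutant X" for R g x z
  proof -
    show "R (A x) = A (R x)" by (rule com[OF R]) (simp add: Xx bl KA pA Ap)
    show "R (K x) = K (R x)" by (rule com[OF R]) (simp add: Xx bl pK)
    show "R (y x) = y (R x)" by (rule com[OF R]) (simp add: Xx bl Ky py)
    show "R (p x) = p (R x)" by (rule com[OF R]) (simp add: Xx bl pK)
    show "R (g x) = g (R x)" if "g \<in> G"
      by (rule com[OF R]) (simp add: Xx bl Kg[OF that] pg[OF that])
    show "inner (R x) z = inner x (R z)" using bicommutantD(1)[OF R] by (simp add: selfadjointD)
  qed
  have Xp: "X (p x) = 0" for x by (simp add: Xx KKp pp)
  have one: "(1::real) \<in> {0..1}" by simp
  have STc: "S r (T x) = T (S r x)" if "r \<in> {0..1}" for r x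
    using bicommutant_commute[OF Sb[OF that] Tb] by (simp add: commutes_def)
  have TS: "T (S 1 x) = x" for x using ST[of x] STc[OF one, of x] by simp
  have Tp: "T (p x) = p x" for x
    using STc[OF one, of "p x"] by (simp add: ST Sfix[OF one Xp])
  have pT: "p (T x) = p x" for x using Rp[OF Tb] Tp by simp
  have Sp: "S r (p x) = p x" if "r \<in> {0..1}" for r x by (rule Sfix[OF that Xp])
  have pS: "p (S r x) = p x" if "r \<in> {0..1}" for r x
    using Rp[OF Sb[OF that]] Sp[OF that] by simp
  have TTX: "T (T x) - X (T (T x)) = x" for x
    using SS[OF one, of "T (T x)"] by (simp add: STc[OF one] TS)
  have AATT: "A (A (T (T x))) = x - p x" for x
    using TTX[of x] by (simp add: AA Xx pT algebra_simps)
  have cA: "cpt (A o\<^sub>L (T - id_blinfun))" by (rule cpt_compose_left[OF Tcpt[OF cX]])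
  have cKp: "cpt (K o\<^sub>L p)" by (rule cpt_compose_left[OF cp])
  have cyp: "cpt (y o\<^sub>L p)" by (rule cpt_compose_left[OF cp])
  let ?S = "{W \<in> saus G. cpt (W - U)}"
  \<comment> \<open>\<open>V0\<close> is the sign of A: its square is 1 - p. On the kernel of
    \<open>p\<close>, \<open>V0\<close> composed with \<open>S (t\<^sup>2)\<close> anticommutes with
    \<open>t *\<^sub>R K\<close>, and their squares are 1 - t^2 K^2 and t^2 K^2, so
    \<open>E t\<close> is an involution there. On the range of \<open>p\<close> it equals K for all
    \<open>t\<close>.\<close>
  define V0 where "V0 = A o\<^sub>L T"
  define E where "E t = (V0 o\<^sub>L S (t\<^sup>2)) + t *\<^sub>R (K - (K o\<^sub>L p)) + (K o\<^sub>L p)" for t :: real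
  have "path_component ?S (E 0) (E 1)"
  proof (rule path_componentI[of E, OF _ _ refl refl])
    have "continuous_on {0..1} (\<lambda>t::real. S (t\<^sup>2))"
      by (rule continuous_on_compose2[OF contS])
        (auto intro!: continuous_intros simp: power_le_one)
    then show "continuous_on {0..1} E" unfolding E_def by (intro continuous_intros)
    fix t :: real assume "t \<in> {0..1}"
    then have t: "t\<^sup>2 \<in> {0..1}" by (auto simp: power_le_one)
    note Sr = RA[OF Sb[OF t]] RK[OF Sb[OF t]] Rsa[OF Sb[OF t]] pS[OF t] Sp[OF t] STc[OF t]
    note Tr = RA[OF Tb] RK[OF Tb] Rsa[OF Tb] pT Tp
    have Ex: "E t x = A (T (S (t\<^sup>2) x)) + t *\<^sub>R (K x - K (p x)) + K (p x)" for x
      by (simp add: E_def V0_def bl)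
    have "E t \<in> saus G"
    proof (rule sausI)
      show "inner (E t x) z = inner x (E t z)" for x z
        by (simp add: Ex inner_add_left inner_add_right inner_diff_left inner_diff_right
            Asa Ksa psa Sr Tr pK)
      show "E t (E t x) = x" for x
        by (simp add: Ex bl Sr Tr AATT KA pA Ap AKp pK pp KKp
            scaleR_diff_right scaleR_add_right flip: power2_eq_square)
          (simp add: SS[OF t] Xx scaleR_diff_right)
      show "E t (g x) = g (E t x)" if "g \<in> G" for g x
        by (simp add: Ex bl Rg[OF Sb[OF t] that] Rg[OF Tb that] Ag[OF that] Kg[OF that] pg[OF that])
    qed
    moreover have "E t - U = (((A o\<^sub>L (T - id_blinfun)) o\<^sub>L S (t\<^sup>2)) + (A o\<^sub>L (S (t\<^sup>2) - id_blinfun)))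
        + (t - 1) *\<^sub>R (K - (K o\<^sub>L p))"
      by (rule blinfun_eqI) (simp add: Ex Ux bl algebra_simps)
    then have "cpt (E t - U)"
      using cpt_compose_right[OF cA, of "S (t\<^sup>2)"] cpt_compose_left[OF Scpt[OF t cX], of A]
      by (simp only:) (intro cpt_add cpt_scaleR cpt_diff cKp cK)
    ultimately show "E t \<in> ?S" by simp
  qed
  note pcE = this
  have E1: "E 1 = U"
    by (rule blinfun_eqI) (simp add: E_def V0_def bl Ux ST flip: STc[OF one])
  \<comment> \<open>Only the range of \<open>p\<close> is rotated: there K and y are anticommuting
    involutions, so the cross terms cancel and cos^2 + sin^2 = 1 gives an involution. At the end
    \<open>V0\<close> and y p both commute with y, hence with \<open>L\<close>.\<close>
  define H where "H t = V0 + cos (t * (pi / 2)) *\<^sub>R (K o\<^sub>L p) + sin (t * (pi / 2)) *\<^sub>R (y o\<^sub>L p)"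
    for t :: real
  have HE: "H 0 = E 0" by (rule blinfun_eqI) (simp add: H_def E_def V0_def bl S0)
  have Hx: "H t x = A (T x) + cos (t * (pi / 2)) *\<^sub>R K (p x) + sin (t * (pi / 2)) *\<^sub>R y (p x)" for t x
    by (simp add: H_def V0_def bl)
  have "H t \<in> ?S" for t
  proof -
    have "H t \<in> saus G"
    proof (rule sausI)
      show "inner (H t x) z = inner x (H t z)" for x z
        by (simp add: Hx inner_add_left inner_add_right Asa Ksa psa ysa Rsa[OF Tb] RA[OF Tb] pK py)
      show "H t (g x) = g (H t x)" if "g \<in> G" for g x
        by (simp add: Hx bl Rg[OF Tb that] Ag[OF that] Kg[OF that] pg[OF that] yg[OF that])
      show "H t (H t x) = x" for x
      proof -
        have "H t (H t x) = x - p x + ((cos (t * (pi / 2)))\<^sup>2 + (sin (t * (pi / 2)))\<^sup>2) *\<^sub>R p x"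
          by (simp only: Hx bl RA[OF Tb] RK[OF Tb] Ry[OF Tb] Tp pT AATT KA pA Ap AKp pK pp py Ay Ky KKp yy
              scaleR_add_left scaleR_add_right power2_eq_square)
            (simp add: bl algebra_simps)
        then show ?thesis by simp
      qed
    qed
    moreover have "H t - U = ((A o\<^sub>L (T - id_blinfun)) + cos (t * (pi / 2)) *\<^sub>R (K o\<^sub>L p)
        + sin (t * (pi / 2)) *\<^sub>R (y o\<^sub>L p)) - K"
      by (rule blinfun_eqI) (simp add: Hx Ux bl)
    then have "cpt (H t - U)"
      by (simp only:) (intro cpt_add cpt_scaleR cpt_diff cK cKp cyp cA)
    ultimately show ?thesis by simp
  qed
  note HS = this
  have contH: "continuous_on {0..1} H" unfolding H_def by (intro continuous_intros)
  have pcH: "path_component ?S (H 0) (H 1)"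
    by (rule path_componentI[of H ?S "H 0" "H 1"]) (rule contH, rule HS, rule refl, rule refl)
  have pc: "path_component ?S U (H 1)"
    by (rule path_component_trans[OF _ pcH]) (use path_component_sym[OF pcE] E1 HE in simp)
  have "commutes (H 1) L"
  proof -
    have Hy: "H 1 (y x) = y (H 1 x)" for x
      by (simp add: Hx bl Ry[OF Tb] Ay py)
    have "L x = (1/2) *\<^sub>R (y x + x)" for x by (simp add: yx)
    then show ?thesis by (simp add: commutes_def bl Hy)
  qed
  moreover have "H 1 \<in> saus G" using HS by simp
  ultimately show ?thesis using that[OF _ _ pc] by blast
qed

section \<open>Projections commuting with a scalar action\<close>

text \<open>Points of the dense set within 1/2 of distinct elements of \<open>B\<close> are
  distinct. It is applied to unit vectors that are pairwise orthogonal.\<close>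

lemma countable_separated:
  fixes B :: "'a::metric_space set"
  assumes A: "countable (A :: 'a set)" "closure A = UNIV"
    and sep: "\<And>x y. x \<in> B \<Longrightarrow> y \<in> B \<Longrightarrow> x \<noteq> y \<Longrightarrow> 1 \<le> dist x y"
  shows "countable B"
proof -
  have "\<exists>a\<in>A. dist a x < 1/2" for x
    using A(2) closure_approachable[of x A] by (metis UNIV_I half_gt_zero zero_less_one)
  then obtain h where h: "\<And>x. h x \<in> A" "\<And>x. dist (h x) x < 1/2" by metis
  have "inj_on h B"
  proof (rule inj_onI, rule ccontr)
    fix x y assume xy: "x \<in> B" "y \<in> B" "h x = h y" "x \<noteq> y"
    have "dist x y \<le> dist (h x) x + dist (h x) y" by (rule dist_triangle3)
    then show False using h(2)[of x] h(2)[of y] sep[OF xy(1,2,4)] xy(3) by simp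
  qed
  moreover have "h ` B \<subseteq> A" using h(1) by blast
  ultimately show ?thesis using A(1) countable_subset countable_image_inj_on by metis
qed

text \<open>
  For \<open>x \<in> R\<close> of norm 1 the vectors \<open>d x\<close>, \<open>d \<in> D\<close>, are an orthonormal basis of the real subspace that
  the operators in \<open>G\<close> generate from \<open>x\<close>. For complex and quaternionic scalars every vector is in \<open>R\<close>,
  for a real structure \<open>C\<close> only those with \<open>C x = x\<close>.
\<close>

locale scalar_action =
  fixes G D :: "('a::{real_inner,banach} \<Rightarrow>\<^sub>L 'a) set" and R :: "'a set"
  assumes G_pm: "g \<in> G \<Longrightarrow> pm_symmetric g"
    and D_finite: "finite D" and D_id: "id_blinfun \<in> D"
    and D_orth: "d \<in> D \<Longrightarrow> d' \<in> D \<Longrightarrow> x \<in> R \<Longrightarrow>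
      inner (blinfun_apply d x) (blinfun_apply d' x) = (if d = d' then inner x x else 0)"
    and G_D: "g \<in> G \<Longrightarrow> d \<in> D \<Longrightarrow> \<exists>d'\<in>D. \<exists>r. \<forall>x\<in>R. blinfun_apply g (blinfun_apply d x) = r *\<^sub>R blinfun_apply d' x"
    and D_inv: "d \<in> D \<Longrightarrow> subspace S \<Longrightarrow> (\<And>g x. g \<in> G \<Longrightarrow> x \<in> S \<Longrightarrow> blinfun_apply g x \<in> S) \<Longrightarrow> x \<in> S \<Longrightarrow>
      blinfun_apply d x \<in> S"
    and R_ex: "subspace S \<Longrightarrow> (\<And>g x. g \<in> G \<Longrightarrow> x \<in> S \<Longrightarrow> blinfun_apply g x \<in> S) \<Longrightarrow> x \<in> S \<Longrightarrow> x \<noteq> 0 \<Longrightarrow>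
      \<exists>y\<in>S \<inter> R. y \<noteq> 0"
    and R_scale: "x \<in> R \<Longrightarrow> r *\<^sub>R x \<in> R"
    and separable: "\<exists>A::'a set. countable A \<and> closure A = UNIV"
begin

text \<open>Orthogonality over the scalars that \<open>G\<close> generates: the whole orbits are
  orthogonal, not just the two vectors.\<close>

definition orth :: "'a \<Rightarrow> 'a \<Rightarrow> bool"
  where "orth x y \<longleftrightarrow> (\<forall>d\<in>D. \<forall>d'\<in>D. inner (blinfun_apply d x) (blinfun_apply d' y) = 0)"

lemma orth_sym: "orth x y \<Longrightarrow> orth y x"
  unfolding orth_def by (metis inner_commute)

lemma orth_inner: "orth x y \<Longrightarrow> inner x y = 0"
  unfolding orth_def using D_id by (metis id_blinfun.rep_eq)

lemma orth_irrefl: "orth x x \<Longrightarrow> norm x \<noteq> 1"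
  using orth_inner[of x x] by auto

definition admissible :: "('a \<Rightarrow>\<^sub>L 'a) \<Rightarrow> bool"
  where "admissible P \<longleftrightarrow> is_proj P \<and> (\<forall>g\<in>G. commutes P g)"

definition orbit_complement :: "('a \<Rightarrow>\<^sub>L 'a) \<Rightarrow> 'a set \<Rightarrow> 'a set"
  where "orbit_complement P F = {x. P x = x \<and> (\<forall>y\<in>F. \<forall>d\<in>D. inner (blinfun_apply d y) x = 0)}"

text \<open>For \<open>y\<close> in \<open>R\<close>, every \<open>g\<close> takes
  \<open>d y\<close> to a multiple of some \<open>d' y\<close>, and \<open>g\<close> is its own
  adjoint up to a factor; so orthogonality to the orbit of \<open>y\<close> survives under
  \<open>g\<close>. Invariance under \<open>G\<close> gives invariance under \<open>D\<close>, which
  upgrades the one-sided condition to \<open>orth\<close>.\<close>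

lemma orbit_complement_invariant:
  assumes P: "admissible P" and F: "F \<subseteq> R"
  shows "subspace (orbit_complement P F)"
    "\<And>g x. g \<in> G \<Longrightarrow> x \<in> orbit_complement P F \<Longrightarrow> blinfun_apply g x \<in> orbit_complement P F"
    "\<And>x y. x \<in> orbit_complement P F \<Longrightarrow> y \<in> F \<Longrightarrow> orth y x"
proof -
  let ?S = "orbit_complement P F"
  have pr: "is_proj P" and com: "\<And>g. g \<in> G \<Longrightarrow> commutes P g" using P by (auto simp: admissible_def)
  have S: "x \<in> ?S \<longleftrightarrow> P x = x \<and> (\<forall>y\<in>F. \<forall>d\<in>D. inner (blinfun_apply d y) x = 0)" for x
    by (simp add: orbit_complement_def)
  show sub: "subspace ?S"
    by (simp add: subspace_def S blinfun.add_right blinfun.scaleR_right inner_add_right)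
  show inv: "g x \<in> ?S" if g: "g \<in> G" and x: "x \<in> ?S" for g x
    unfolding S
  proof (intro conjI ballI)
    show "P (g x) = g x" using commutesD[OF com[OF g]] x S by simp
    fix y d assume yd: "y \<in> F" "d \<in> D"
    obtain d' r where d': "d' \<in> D" "\<And>z. z \<in> R \<Longrightarrow> g (blinfun_apply d z) = r *\<^sub>R blinfun_apply d' z"
      using G_D[OF g yd(2)] by blast
    obtain c where c: "\<And>z w. inner (g z) w = c * inner z (g w)"
      using G_pm[OF g] unfolding pm_symmetric_def by blast
    have "inner (d y) (g x) = c * inner x (g (d y))"
      by (simp add: inner_commute[of "d y"] c)
    also have "\<dots> = c * r * inner (d' y) x"
      using d'(2) yd(1) F by (simp add: subset_iff inner_commute)
    also have "\<dots> = 0" using x S yd(1) d'(1) by simp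
    finally show "inner (d y) (g x) = 0" .
  qed
  show "orth y x" if "x \<in> ?S" "y \<in> F" for x y
    unfolding orth_def
  proof (intro ballI)
    fix d d' assume "d \<in> D" "d' \<in> D"
    then have "d' x \<in> ?S" using D_inv[OF _ sub inv that(1)] by blast
    then show "inner (d y) (d' x) = 0" using S that(2) \<open>d \<in> D\<close> by blast
  qed
qed

text \<open>Finitely many orbits under the finite set \<open>D\<close> impose finitely many
  conditions, so a nonzero solution is left in the range of \<open>P\<close>. The solutions form an
  invariant subspace, which therefore meets \<open>R\<close> in a nonzero vector.\<close>

lemma ex_unit_orth:
  assumes P: "admissible P" and inf: "inf_dim (range P)" and F: "finite F" "F \<subseteq> R"
  obtains x where "x \<in> R" "norm x = 1" "P x = x" "\<And>y. y \<in> F \<Longrightarrow> orth y x"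
proof -
  have pr: "is_proj P" using P by (simp add: admissible_def)
  note S = orbit_complement_invariant[OF P F(2)]
  let ?O = "\<Union>y\<in>F. (\<lambda>d. blinfun_apply d y) ` D"
  have "subspace (range P)"
    by (simp add: subspace_def is_proj_range[OF pr] blinfun.add_right blinfun.scaleR_right)
  then have "inf_dim {x\<in>range P. \<forall>f\<in>?O. inner f x = 0}"
    using F(1) D_finite inf by (intro inf_dim_orthogonal) auto
  also have "{x\<in>range P. \<forall>f\<in>?O. inner f x = 0} = orbit_complement P F"
    by (auto simp: orbit_complement_def is_proj_range[OF pr])
  finally obtain x0 where x0: "x0 \<in> orbit_complement P F" "x0 \<noteq> 0" using inf_dim_nonzero by blast
  from R_ex[OF S(1) S(2) x0] obtain x where x: "x \<in> orbit_complement P F" "x \<in> R" "x \<noteq> 0"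
    by blast
  let ?x = "x /\<^sub>R norm x"
  have xS: "?x \<in> orbit_complement P F" using S(1) x(1) by (rule subspace_scale)
  show ?thesis
  proof (rule that)
    show "?x \<in> R" using R_scale x(2) by blast
    show "norm ?x = 1" using x(3) by simp
    show "P ?x = ?x" using xS by (simp add: orbit_complement_def)
    show "orth y ?x" if "y \<in> F" for y using S(3)[OF xS that] .
  qed
qed

section \<open>Orthonormal bases made of orbits\<close>

definition good_seq :: "(nat \<Rightarrow> 'a) \<Rightarrow> bool"
  where "good_seq e \<longleftrightarrow> (\<forall>n. e n \<in> R \<and> norm (e n) = 1) \<and> (\<forall>m n. m \<noteq> n \<longrightarrow> orth (e m) (e n))"

definition orbit :: "(nat \<Rightarrow> 'a) \<Rightarrow> nat \<times> ('a \<Rightarrow>\<^sub>L 'a) \<Rightarrow> 'a"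
  where "orbit e i = blinfun_apply (snd i) (e (fst i))"

abbreviation Idx :: "(nat \<times> ('a \<Rightarrow>\<^sub>L 'a)) set"
  where "Idx \<equiv> UNIV \<times> D"

abbreviation shift :: "(nat \<Rightarrow> 'a) \<Rightarrow> (nat \<Rightarrow> 'a) \<Rightarrow> 'a \<Rightarrow>\<^sub>L 'a"
  where "shift e f \<equiv> shift_op Idx (orbit e) (orbit f)"

lemma infinite_Idx: "infinite Idx"
  using D_id by (auto simp: finite_cartesian_product_iff)

lemma orthonormal_orbit: "good_seq e \<Longrightarrow> orthonormal_on Idx (orbit e)"
  unfolding orthonormal_on_def
proof (intro ballI)
  fix i j assume e: "good_seq e" and i: "i \<in> Idx" and j: "j \<in> Idx"
  obtain m d n d' where ij: "i = (m, d)" "j = (n, d')" by (cases i, cases j)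
  have D: "d \<in> D" "d' \<in> D" using i j ij by auto
  show "inner (orbit e i) (orbit e j) = (if i = j then 1 else 0)"
    using e D_orth[OF D, of "e n"] D
    by (cases "m = n") (auto simp: ij orbit_def good_seq_def orth_def norm_eq_1)
qed

lemma orbit_fixed:
  assumes P: "admissible P" and e: "\<And>n. P (e n) = e n" and i: "i \<in> Idx"
  shows "P (orbit e i) = orbit e i"
proof -
  have pr: "is_proj P" and com: "\<And>g. g \<in> G \<Longrightarrow> commutes P g" using P by (auto simp: admissible_def)
  have "orbit e i \<in> {x. P x = x}"
    unfolding orbit_def
  proof (rule D_inv)
    show "snd i \<in> D" using i by auto
    show "subspace {x. P x = x}" by (simp add: subspace_def blinfun.add_right blinfun.scaleR_right)
    show "g x \<in> {x. P x = x}" if "g \<in> G" "x \<in> {x. P x = x}" for g x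
      using commutesD[OF com[OF that(1)]] that(2) by simp
  qed (simp add: e)
  then show ?thesis by simp
qed

lemma inner_orbit_0:
  "(\<And>m n. orth (e m) (f n)) \<Longrightarrow> i \<in> Idx \<Longrightarrow> j \<in> Idx \<Longrightarrow> inner (orbit e i) (orbit f j) = 0"
  unfolding orbit_def orth_def by auto

text \<open>\<open>g\<close> acts on the orbit of \<open>e n\<close> by the same formula as on the
  orbit of \<open>f n\<close>, so a shift that matches the two intertwines the actions. Off the
  orbits, symmetry up to a factor does the work.\<close>

lemma shift_commutes:
  assumes e: "good_seq e" and f: "good_seq f" and g: "g \<in> G"
  shows "commutes (shift e f) g"
  unfolding commutes_def
proof
  fix x
  note oe = orthonormal_orbit[OF e] and orf = orthonormal_orbit[OF f]
  obtain c where c: "\<And>z w. inner (g z) w = c * inner z (g w)"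
    using G_pm[OF g] unfolding pm_symmetric_def by blast
  \<comment> \<open>One index \<open>j\<close> and one factor \<open>r\<close> serve both sequences
    because \<open>G_D\<close> chooses them uniformly over \<open>R\<close>.\<close>
  have g_orbit: "\<exists>j\<in>Idx. \<exists>r. g (orbit e i) = r *\<^sub>R orbit e j \<and> g (orbit f i) = r *\<^sub>R orbit f j"
    if i: "i \<in> Idx" for i
  proof -
    have "snd i \<in> D" using i by auto
    from G_D[OF g this] obtain d' r where "d' \<in> D" "\<forall>x\<in>R. g (snd i x) = r *\<^sub>R d' x"
      by blast
    then show ?thesis
      using e f by (intro bexI[of _ "(fst i, d')"] exI[of _ r]) (auto simp: orbit_def good_seq_def)
  qed
  \<comment> \<open>The difference is orthogonal to everything orthogonal to the orbits of
    \<open>f\<close>, and also to these orbits. The second fact lets the difference itself be used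
    in the first, so it is orthogonal to itself.\<close>
  let ?y = "shift e f (g x) - g (shift e f x)"
  have y: "inner z ?y = 0" if z: "\<And>i. i \<in> Idx \<Longrightarrow> inner (orbit f i) z = 0" for z
  proof -
    have "inner z (shift e f (g x)) = 0"
      by (rule inner_shift_op_orthogonal[OF oe orf z])
    moreover have "inner (g z) (shift e f x) = 0"
    proof (rule inner_shift_op_orthogonal[OF oe orf])
      fix i assume "i \<in> Idx"
      then obtain j r where j: "j \<in> Idx" "g (orbit f i) = r *\<^sub>R orbit f j" using g_orbit by blast
      have "inner (orbit f i) (g z) = c * inner z (g (orbit f i))"
        by (simp add: inner_commute[of "orbit f i"] c)
      then show "inner (orbit f i) (g z) = 0" using z[OF j(1)] j(2) by (simp add: inner_commute)
    qed
    then have "inner z (g (shift e f x)) = 0"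
      by (simp add: inner_commute[of z] inner_commute[of "g z"] c)
    ultimately show ?thesis by (simp add: inner_diff_right)
  qed
  have "inner (orbit f i) ?y = 0" if i: "i \<in> Idx" for i
  proof -
    obtain j r where j: "j \<in> Idx" "g (orbit e i) = r *\<^sub>R orbit e j" "g (orbit f i) = r *\<^sub>R orbit f j"
      using g_orbit[OF i] by blast
    have "inner (orbit f i) (shift e f (g x)) = inner (orbit e i) (g x)"
      by (rule inner_shift_op_basis[OF oe orf i])
    also have "\<dots> = c * r * inner (orbit e j) x"
      by (simp add: inner_commute[of _ "g x"] c j(2)) (simp add: inner_commute)
    also have "\<dots> = c * r * inner (orbit f j) (shift e f x)"
      by (simp add: inner_shift_op_basis[OF oe orf j(1)])
    also have "\<dots> = inner (orbit f i) (g (shift e f x))"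
      by (simp add: inner_commute[of _ "g (shift e f x)"] c j(3)) (simp add: inner_commute)
    finally show ?thesis by (simp add: inner_diff_right)
  qed
  then have "inner ?y ?y = 0" by (rule y)
  then show "shift e f (g x) = g (shift e f x)" by simp
qed

text \<open>A maximal \<open>orth\<close>-family of unit vectors of \<open>R\<close> in the range of
  \<open>P\<close> is infinite by \<open>ex_unit_orth\<close> and countable by separability.
  Enumerating it bijectively by the natural numbers gives all bases the same index set
  \<open>Idx\<close>.\<close>

lemma ex_basis:
  assumes P: "admissible P" and inf: "inf_dim (range P)"
  obtains e where "good_seq e" "\<And>n. P (e n) = e n" "P = shift e e"
proof -
  have pr: "is_proj P" using P by (simp add: admissible_def)
  define X where "X = {x\<in>R. norm x = 1 \<and> P x = x}"
  from ex_maximal_pairwise[of orth X, OF orth_sym] obtain B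
    where B: "B \<subseteq> X" "pairwise orth B" "\<forall>x\<in>X. (\<forall>y\<in>B. orth x y) \<longrightarrow> x \<in> B"
    by blast
  have BR: "B \<subseteq> R" using B(1) by (auto simp: X_def)
  have "infinite B"
  proof
    assume "finite B"
    then obtain x where x: "x \<in> R" "norm x = 1" "P x = x" "\<And>y. y \<in> B \<Longrightarrow> orth y x"
      using ex_unit_orth[OF P inf _ BR] by blast
    then have "x \<in> X" "\<forall>y\<in>B. orth x y" using orth_sym by (auto simp: X_def)
    then have "x \<in> B" using B(3) by blast
    then show False using x orth_irrefl by blast
  qed
  moreover have "countable B"
  proof -
    obtain A where A: "countable A" "closure A = (UNIV :: 'a set)" using separable by blast
    show ?thesis
    proof (rule countable_separated[OF A])
      fix x y assume xy: "x \<in> B" "y \<in> B" "x \<noteq> y"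
      then have "inner x x = 1" "inner y y = 1" "inner x y = 0" "inner y x = 0"
        using B(1) orth_inner[OF pairwiseD[OF B(2)]] by (auto simp: X_def norm_eq_1)
      then have "(norm (x - y))\<^sup>2 = 2"
        unfolding power2_norm_eq_inner inner_diff_left inner_diff_right by linarith
      then show "1 \<le> dist x y"
        using power2_le_imp_le[of 1 "norm (x - y)"] by (simp add: dist_norm)
    qed
  qed
  ultimately have bij: "bij_betw (from_nat_into B) UNIV B" by (intro bij_betw_from_nat_into)
  define e where "e = from_nat_into B"
  have eB: "e n \<in> B" for n using bij unfolding e_def bij_betw_def by blast
  have e_inj: "e m \<noteq> e n" if "m \<noteq> n" for m n
    using bij that unfolding e_def bij_betw_def by (auto dest: injD)
  have e_surj: "\<exists>n. b = e n" if "b \<in> B" for b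
    using bij that unfolding e_def bij_betw_def by blast
  have e: "good_seq e"
    unfolding good_seq_def using eB B(1) pairwiseD[OF B(2) eB eB e_inj] by (auto simp: X_def)
  have Pe: "P (e n) = e n" for n using eB B(1) by (auto simp: X_def)
  let ?S = "orbit_complement P B"
  note S = orbit_complement_invariant[OF P BR]
  have "P = shift e e"
  proof (rule is_proj_eq_shift_op[OF pr orthonormal_orbit[OF e]])
    show "P (orbit e i) = orbit e i" if "i \<in> Idx" for i by (rule orbit_fixed[OF P Pe that])
    fix x assume x: "P x = x" "\<And>i. i \<in> Idx \<Longrightarrow> inner (orbit e i) x = 0"
    have "inner (d y) x = 0" if "y \<in> B" "d \<in> D" for y d
      using e_surj[OF that(1)] x(2)[of "(_, d)"] that(2) by (auto simp: orbit_def)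
    then have xS: "x \<in> ?S" using x(1) by (simp add: orbit_complement_def)
    show "x = 0"
    proof (rule ccontr)
      assume "x \<noteq> 0"
      \<comment> \<open>The vector \<open>x\<close> itself need not lie in \<open>R\<close>; the
        invariant complement contains some other nonzero vector that does, and its normalization
        contradicts maximality.\<close>
      from R_ex[OF S(1) S(2) xS this] obtain y where y: "y \<in> ?S" "y \<in> R" "y \<noteq> 0" by blast
      let ?y = "y /\<^sub>R norm y"
      have yS: "?y \<in> ?S" using S(1) y(1) by (rule subspace_scale)
      have "orth ?y b" if "b \<in> B" for b using S(3)[OF yS that] by (rule orth_sym)
      moreover have "?y \<in> X"
        using R_scale[OF y(2)] y(3) yS by (simp add: X_def orbit_complement_def)
      ultimately have "?y \<in> B" using B(3) by blast
      then have "orth ?y ?y" using S(3)[OF yS] by blast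
      then show False using orth_irrefl[of ?y] y(3) by simp
    qed
  qed
  then show ?thesis using that e Pe by blast
qed

text \<open>The ranges of \<open>P\<close> and \<open>Q\<close> may be in any relative position and
  may even coincide, so the sequences are chosen together, as a maximal family of pairs all of whose
  entries are mutually orthogonal.\<close>

lemma ex_orthogonal_sequences:
  assumes P: "admissible P" "inf_dim (range P)" and Q: "admissible Q" "inf_dim (range Q)"
  obtains e f where "good_seq e" "good_seq f" "\<And>n. P (e n) = e n" "\<And>n. Q (f n) = f n"
    "\<And>m n. orth (e m) (f n)"
proof -
  define r where "r x y \<longleftrightarrow> orth (fst x) (fst y) \<and> orth (snd x) (snd y) \<and>
      orth (fst x) (snd y) \<and> orth (snd x) (fst y)" for x y
  define X where "X = {x. fst x \<in> R \<and> norm (fst x) = 1 \<and> P (fst x) = fst x \<and>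
      snd x \<in> R \<and> norm (snd x) = 1 \<and> Q (snd x) = snd x \<and> orth (fst x) (snd x)}"
  have "r y x" if "r x y" for x y using that by (simp add: r_def orth_sym)
  from ex_maximal_pairwise[of r X, OF this] obtain B
    where B: "B \<subseteq> X" "pairwise r B" "\<forall>x\<in>X. (\<forall>y\<in>B. r x y) \<longrightarrow> x \<in> B"
    by blast
  have "infinite B"
  proof
    assume "finite B"
    then have F: "finite (fst ` B \<union> snd ` B)" "fst ` B \<union> snd ` B \<subseteq> R" using B(1) by (auto simp: X_def)
    obtain x where x: "x \<in> R" "norm x = 1" "P x = x" "\<And>y. y \<in> fst ` B \<union> snd ` B \<Longrightarrow> orth y x"
      using ex_unit_orth[OF P F] by blast
    \<comment> \<open>Putting \<open>x\<close> into the finite set makes the second entry orthogonal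
      to the first one of the same pair.\<close>
    have F': "finite (insert x (fst ` B \<union> snd ` B))" "insert x (fst ` B \<union> snd ` B) \<subseteq> R"
      using F x(1) by auto
    obtain y where y: "y \<in> R" "norm y = 1" "Q y = y"
      "\<And>z. z \<in> insert x (fst ` B \<union> snd ` B) \<Longrightarrow> orth z y"
      using ex_unit_orth[OF Q F'] by blast
    have "(x, y) \<in> X" using x(1-3) y by (simp add: X_def)
    moreover have "r (x, y) z" if "z \<in> B" for z
    proof -
      have "fst z \<in> fst ` B \<union> snd ` B" "snd z \<in> fst ` B \<union> snd ` B" using that by auto
      then show ?thesis using x(4) y(4) by (simp add: r_def orth_sym)
    qed
    ultimately have "(x, y) \<in> B" using B(3) by blast
    then have "orth x x" using x(4)[of x] by force
    then show False using x(2) orth_irrefl by blast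
  qed
  then obtain s :: "nat \<Rightarrow> 'a \<times> 'a" where s: "inj s" "range s \<subseteq> B"
    using infinite_countable_subset by blast
  have sB: "s n \<in> B" for n using s(2) by blast
  then have "s n \<in> X" for n using B(1) by blast
  note sX = this[unfolded X_def, simplified]
  have "r (s m) (s n)" if "m \<noteq> n" for m n
    using pairwiseD[OF B(2) sB sB] s(1) that by (auto dest: injD)
  note sr = this[unfolded r_def]
  show ?thesis
  proof (rule that[of "\<lambda>n. fst (s n)" "\<lambda>n. snd (s n)"])
    show "orth (fst (s m)) (snd (s n))" for m n
      using sX[of m] sr[of m n] by (cases "m = n") auto
    show "good_seq (\<lambda>n. fst (s n))" "good_seq (\<lambda>n. snd (s n))"
      unfolding good_seq_def using sX sr by simp_all
    show "P (fst (s n)) = fst (s n)" "Q (snd (s n)) = snd (s n)" for n using sX by simp_all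
  qed
qed

section \<open>Path-connectedness of the projections of infinite rank and corank below a given
  one\<close>

definition half_projs :: "('a \<Rightarrow>\<^sub>L 'a) \<Rightarrow> ('a \<Rightarrow>\<^sub>L 'a) set"
  where "half_projs L = {P. admissible P \<and> (\<forall>x. L (P x) = P x) \<and> inf_dim (range P) \<and> inf_dim (range (L - P))}"

lemma half_projs_rotate:
  assumes L: "admissible L" and e: "good_seq e" and f: "good_seq f" and ef: "\<And>m n. orth (e m) (f n)"
    and Le: "\<And>n. L (e n) = e n" and Lf: "\<And>n. L (f n) = f n"
  shows "path_component (half_projs L) (shift e e) (shift f f)"
proof -
  note bl = blinfun.bilinear_simps
  note oe = orthonormal_orbit[OF e] and orf = orthonormal_orbit[OF f]
  have ef0: "inner (orbit e i) (orbit f j) = 0" and fe0: "inner (orbit f j) (orbit e i) = 0"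
    if "i \<in> Idx" "j \<in> Idx" for i j
    using inner_orbit_0[OF ef that] by (simp_all add: inner_commute)
  \<comment> \<open>This is the projection onto the closed span of the vectors cos e_i + sin f_i,
    over the orbit bases. Expanding it into four fixed shifts makes norm continuity in
    \<open>t\<close> evident.\<close>
  define H where "H t = (cos (t * (pi / 2)))\<^sup>2 *\<^sub>R shift e e + (sin (t * (pi / 2)))\<^sup>2 *\<^sub>R shift f f
      + (cos (t * (pi / 2)) * sin (t * (pi / 2))) *\<^sub>R (shift e f + shift f e)" for t :: real
  show ?thesis
  proof (rule path_componentI[of H])
    show "continuous_on {0..1} H" unfolding H_def by (intro continuous_intros)
    show "H 0 = shift e e" "H 1 = shift f f" by (simp_all add: H_def)
    fix t :: real
    define c s where "c = cos (t * (pi / 2))" and "s = sin (t * (pi / 2))"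
    have cs: "c\<^sup>2 + s\<^sup>2 = 1" by (simp add: c_def s_def)
    have Hx: "H t x = c\<^sup>2 *\<^sub>R shift e e x + s\<^sup>2 *\<^sub>R shift f f x + (c * s) *\<^sub>R (shift e f x + shift f e x)" for x
      by (simp add: H_def bl c_def s_def)
    have z: "shift a b (shift e' f' x) = 0"
      if "good_seq a" "good_seq b" "good_seq e'" "good_seq f'"
        "\<And>i j. i \<in> Idx \<Longrightarrow> j \<in> Idx \<Longrightarrow> inner (orbit f' i) (orbit a j) = 0" for a b e' f' x
      by (rule shift_op_compose_0) (use that orthonormal_orbit in blast)+
    have H_compose: "H t (H t x) = H t x" for x
    proof -
      have "H t (H t x) = (c\<^sup>2 * c\<^sup>2 + (c * s) * (c * s)) *\<^sub>R shift e e x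
          + (s\<^sup>2 * s\<^sup>2 + (c * s) * (c * s)) *\<^sub>R shift f f x
          + (c\<^sup>2 * (c * s) + s\<^sup>2 * (c * s)) *\<^sub>R (shift e f x + shift f e x)"
        unfolding Hx
        by (simp add: bl shift_op_compose oe orf z e f ef0 fe0 algebra_simps)
      also have "c\<^sup>2 * c\<^sup>2 + (c * s) * (c * s) = c\<^sup>2 * (c\<^sup>2 + s\<^sup>2)" by (simp add: power2_eq_square algebra_simps)
      also have "s\<^sup>2 * s\<^sup>2 + (c * s) * (c * s) = s\<^sup>2 * (c\<^sup>2 + s\<^sup>2)" by (simp add: power2_eq_square algebra_simps)
      also have "c\<^sup>2 * (c * s) + s\<^sup>2 * (c * s) = (c\<^sup>2 + s\<^sup>2) * (c * s)" by (simp add: algebra_simps)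
      finally show ?thesis by (simp add: cs Hx)
    qed
    have "selfadjoint (H t)"
      unfolding selfadjoint_def Hx
      by (simp add: inner_add_left inner_add_right shift_op_adjoint[OF oe oe] shift_op_adjoint[OF oe orf]
          shift_op_adjoint[OF orf oe] shift_op_adjoint[OF orf orf] algebra_simps)
    then have "is_proj (H t)" by (simp add: is_proj_def H_compose)
    moreover have "commutes (H t) g" if "g \<in> G" for g
      unfolding commutes_def Hx
      using shift_commutes[OF e e that] shift_commutes[OF e f that] shift_commutes[OF f e that]
        shift_commutes[OF f f that]
      by (simp add: commutes_def bl)
    ultimately have adm: "admissible (H t)" by (simp add: admissible_def)
    have closed: "closed {x. L x = x}" by (intro closed_Collect_eq continuous_intros)
    have sub: "subspace {x. L x = x}" by (simp add: subspace_def bl)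
    have Lo: "L (orbit e i) = orbit e i" "L (orbit f i) = orbit f i" if "i \<in> Idx" for i
      using orbit_fixed[OF L _ that] Le Lf by blast+
    have Ls: "L (shift a b x) = shift a b x"
      if "good_seq a" "good_seq b" "\<And>i. i \<in> Idx \<Longrightarrow> L (orbit b i) = orbit b i" for a b x
      using shift_op_closed[OF orthonormal_orbit orthonormal_orbit closed sub, of a b x] that by simp
    have LH: "L (H t x) = H t x" for x
      unfolding Hx by (simp add: bl Ls e f Lo)
    have He: "H t (orbit e i) = c *\<^sub>R (c *\<^sub>R orbit e i + s *\<^sub>R orbit f i)"
      and Hf: "H t (orbit f i) = s *\<^sub>R (c *\<^sub>R orbit e i + s *\<^sub>R orbit f i)" if i: "i \<in> Idx" for i
      unfolding Hx
      using i by (simp_all add: shift_op_basis[OF oe oe] shift_op_basis[OF oe orf] shift_op_basis[OF orf oe]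
          shift_op_basis[OF orf orf] shift_op_orthogonal[OF oe oe] shift_op_orthogonal[OF oe orf]
          shift_op_orthogonal[OF orf oe] shift_op_orthogonal[OF orf orf] ef0 fe0
          power2_eq_square algebra_simps)
    have on: "orthonormal_on Idx (\<lambda>i. a *\<^sub>R orbit e i + b *\<^sub>R orbit f i)" if "a\<^sup>2 + b\<^sup>2 = 1" for a b
      using that
      by (simp add: orthonormal_on_def inner_add_left inner_add_right ef0 fe0
          orthonormal_onD[OF oe] orthonormal_onD[OF orf] power2_eq_square)
    have "inf_dim (range (H t))"
    proof (rule inf_dim_orthonormal[OF on[OF cs] infinite_Idx])
      fix i assume i: "i \<in> Idx"
      have "H t (c *\<^sub>R orbit e i + s *\<^sub>R orbit f i) = (c\<^sup>2 + s\<^sup>2) *\<^sub>R (c *\<^sub>R orbit e i + s *\<^sub>R orbit f i)"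
        by (simp add: bl He[OF i] Hf[OF i] power2_eq_square scaleR_add_left)
      then show "c *\<^sub>R orbit e i + s *\<^sub>R orbit f i \<in> range (H t)"
        by (simp add: cs) (metis rangeI)
    qed
    moreover have "inf_dim (range (L - H t))"
    proof (rule inf_dim_orthonormal[OF on infinite_Idx])
      show "(- s)\<^sup>2 + c\<^sup>2 = 1" using cs by simp
      fix i assume i: "i \<in> Idx"
      \<comment> \<open>The vectors -sin e_i + cos f_i are orthogonal to the rotated ones and
        witness the infinite corank below \<open>L\<close>.\<close>
      have "(L - H t) (- s *\<^sub>R orbit e i + c *\<^sub>R orbit f i) = - s *\<^sub>R orbit e i + c *\<^sub>R orbit f i"
        by (simp add: bl He[OF i] Hf[OF i] Lo[OF i] algebra_simps)
      then show "- s *\<^sub>R orbit e i + c *\<^sub>R orbit f i \<in> range (L - H t)" by (metis rangeI)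
    qed
    ultimately show "H t \<in> half_projs L" by (simp add: half_projs_def adm LH)
  qed
qed

lemma half_projs_complement:
  assumes L: "admissible L" and P: "P \<in> half_projs L"
  shows "P (L x) = P x" "admissible (L - P)"
proof -
  have pr: "is_proj L" "is_proj P" and LP: "\<And>x. L (P x) = P x"
    and com: "\<And>g. g \<in> G \<Longrightarrow> commutes P g" "\<And>g. g \<in> G \<Longrightarrow> commutes L g"
    using assms by (auto simp: half_projs_def admissible_def)
  have PL: "P (L x) = P x" for x
  proof -
    have "inner (P (L x) - P x) y = 0" for y
      using LP[of y] by (simp add: inner_diff_left is_projD(2)[OF pr(1)] is_projD(2)[OF pr(2)])
    then show ?thesis by (metis inner_eq_zero_iff right_minus_eq)
  qed
  then show "P (L x) = P x" .
  show "admissible (L - P)"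
    using com PL LP
    by (simp add: admissible_def is_proj_def selfadjoint_def commutes_def blinfun.bilinear_simps
        inner_diff_left inner_diff_right is_projD[OF pr(1)] is_projD[OF pr(2)])
qed

text \<open>The auxiliary sequences are taken in the ranges of \<open>L - P\<close> and
  \<open>L - Q\<close>, not merely in the kernels of \<open>P\<close> and \<open>Q\<close>, so that
  all three rotations stay below \<open>L\<close>.\<close>

lemma path_connected_half_projs:
  assumes L: "admissible L"
  shows "path_connected (half_projs L)"
  unfolding path_connected_component
proof (intro ballI)
  fix P Q assume P: "P \<in> half_projs L" and Q: "Q \<in> half_projs L"
  have fixL: "L x = x" if "(L - P') x = x" "P' \<in> half_projs L" for P' x
  proof -
    have "L ((L - P') x) = (L - P') x"
      using L that(2) by (simp add: half_projs_def admissible_def is_projD(1) blinfun.bilinear_simps)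
    then show ?thesis using that(1) by simp
  qed
  have orthP: "orth x y" if "P' \<in> half_projs L" "P' x = x" "(L - P') y = y" for P' x y
    unfolding orth_def
  proof (intro ballI)
    fix d d' assume d: "d \<in> D" "d' \<in> D"
    have adm: "admissible P'" "admissible (L - P')"
      using that(1) half_projs_complement(2)[OF L that(1)] by (auto simp: half_projs_def)
    \<comment> \<open>A constant sequence turns \<open>orbit_fixed\<close> into a statement about
      the single vector \<open>d x\<close>.\<close>
    have "P' (orbit (\<lambda>_. x) (0, d)) = orbit (\<lambda>_. x) (0, d)"
      by (rule orbit_fixed[OF adm(1)]) (use that(2) d in auto)
    then have dx: "P' (d x) = d x" by (simp add: orbit_def)
    have "(L - P') (orbit (\<lambda>_. y) (0, d')) = orbit (\<lambda>_. y) (0, d')"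
      by (rule orbit_fixed[OF adm(2)]) (use that(3) d in auto)
    then have dy: "L (d' y) - P' (d' y) = d' y" by (simp add: orbit_def blinfun.diff_left)
    have pr: "is_proj P'" using adm(1) by (simp add: admissible_def)
    have "P' (d' y) = P' (L (d' y) - P' (d' y))" using dy by simp
    also have "\<dots> = 0"
      by (simp add: blinfun.diff_right half_projs_complement(1)[OF L that(1)] is_projD(1)[OF pr])
    finally show "inner (d x) (d' y) = 0"
      using is_projD(2)[OF pr, of "d x" "d' y"] dx by simp
  qed
  have aP: "admissible P" "inf_dim (range P)" "inf_dim (range (L - P))"
    and aQ: "admissible Q" "inf_dim (range Q)" "inf_dim (range (L - Q))"
    using P Q by (auto simp: half_projs_def)
  obtain u where u: "good_seq u" "\<And>n. P (u n) = u n" "P = shift u u" using ex_basis[OF aP(1,2)] by blast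
  obtain v where v: "good_seq v" "\<And>n. Q (v n) = v n" "Q = shift v v" using ex_basis[OF aQ(1,2)] by blast
  obtain e f where ef: "good_seq e" "good_seq f" "\<And>n. (L - P) (e n) = e n" "\<And>n. (L - Q) (f n) = f n"
    "\<And>m n. orth (e m) (f n)"
    using ex_orthogonal_sequences[OF half_projs_complement(2)[OF L P] aP(3)
        half_projs_complement(2)[OF L Q] aQ(3)] by blast
  have Lu: "L (u n) = u n" for n using P u(2) by (metis (mono_tags, lifting) half_projs_def mem_Collect_eq)
  have Lv: "L (v n) = v n" for n using Q v(2) by (metis (mono_tags, lifting) half_projs_def mem_Collect_eq)
  note Le = fixL[OF ef(3) P] and Lf = fixL[OF ef(4) Q]
  have "path_component (half_projs L) P (shift e e)"
    unfolding u(3) by (rule half_projs_rotate[OF L u(1) ef(1) orthP[OF P u(2) ef(3)] Lu Le])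
  moreover have "path_component (half_projs L) (shift e e) (shift f f)"
    by (rule half_projs_rotate[OF L ef(1,2,5) Le Lf])
  moreover have "path_component (half_projs L) (shift f f) Q"
    unfolding v(3)
    by (rule half_projs_rotate[OF L ef(2) v(1) orth_sym[OF orthP[OF Q v(2) ef(4)]] Lf Lv])
  ultimately show "path_component (half_projs L) P Q"
    using path_component_trans by metis
qed

text \<open>For two orthogonal sequences in the range of \<open>L\<close>, the span of either has
  infinite corank because of the other; the endpoint of the rotation path already records
  this.\<close>

lemma half_projs_nonempty:
  assumes L: "admissible L" and inf: "inf_dim (range L)"
  shows "half_projs L \<noteq> {}"
proof -
  obtain e f where ef: "good_seq e" "good_seq f" "\<And>n. L (e n) = e n" "\<And>n. L (f n) = f n"
    "\<And>m n. orth (e m) (f n)"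
    using ex_orthogonal_sequences[OF L inf L inf] by blast
  show ?thesis
    using half_projs_rotate[OF L ef(1,2,5,3,4)] path_component_mem(1) by blast
qed

end

section \<open>Self-adjoint unitaries commuting with a projection\<close>

text \<open>If the eigenspace of \<open>W\<close> were finite-dimensional, infinitely many
  dimensions of eigenvectors of \<open>V\<close> would be orthogonal to it. On those
  \<open>W\<close> acts as \<open>- s\<close>, so the compact \<open>W - V\<close> would act as the
  nonzero scalar \<open>- 2 * s\<close>.\<close>

lemma inf_dim_eigenspace_cpt:
  fixes V W :: "'a::{real_inner,banach} \<Rightarrow>\<^sub>L 'a"
  assumes M: "subspace M" and WM: "\<And>x. x \<in> M \<Longrightarrow> W x \<in> M"
    and W: "selfadjoint W" "\<And>x. W (W x) = x" and cpt: "cpt (W - V)" and s: "s * s = (1::real)"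
    and inf: "inf_dim {x\<in>M. V x = s *\<^sub>R x}"
  shows "inf_dim {x\<in>M. W x = s *\<^sub>R x}"
proof (rule ccontr)
  assume "\<not> ?thesis"
  then obtain B where B: "finite B" "{x\<in>M. W x = s *\<^sub>R x} \<subseteq> span B" unfolding inf_dim_def by blast
  let ?E = "{x\<in>M. V x = s *\<^sub>R x}"
  let ?N = "{x\<in>?E. \<forall>b\<in>B. inner b x = 0}"
  have E: "subspace ?E"
    using M by (simp add: subspace_def blinfun.add_right blinfun.scaleR_right scaleR_add_right)
  have N: "subspace ?N"
    using E by (simp add: subspace_def inner_add_right)
  have infN: "inf_dim ?N" by (rule inf_dim_orthogonal[OF B(1) E inf])
  have ss: "s *\<^sub>R s *\<^sub>R x = x" for x :: 'a using s by simp
  have eig: "(W - V) x = (- 2 * s) *\<^sub>R x" if "x \<in> ?N" for x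
  proof -
    have x: "x \<in> M" "V x = s *\<^sub>R x" "\<And>b. b \<in> B \<Longrightarrow> inner b x = 0" using that by auto
    \<comment> \<open>Twice the projection of \<open>x\<close> to the eigenspace of
      \<open>W\<close>. It lies in \<open>span B\<close>, to which \<open>x\<close> is orthogonal,
      so it vanishes.\<close>
    let ?y = "x + s *\<^sub>R W x"
    have "?y \<in> M" using M x(1) WM by (simp add: subspace_add subspace_scale)
    moreover have "W ?y = s *\<^sub>R ?y"
      by (simp only: blinfun.add_right blinfun.scaleR_right W(2) scaleR_add_right ss add.commute)
    ultimately have "?y \<in> span B" using B(2) by blast
    then have xy: "inner ?y x = 0"
      by (rule span_induct) (auto simp: subspace_def inner_add_left x(3))
    have "inner (W x) (W x) = inner x x" using selfadjointD[OF W(1), of x "W x"] W(2) by simp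
    then have "inner ?y ?y = 2 * inner ?y x"
      using s by (simp add: inner_add_left inner_add_right inner_commute)
    then have "?y = 0" using xy by simp
    then have "s *\<^sub>R (s *\<^sub>R W x) = s *\<^sub>R (- x)" by (metis add.inverse_unique)
    then have "W x = - (s *\<^sub>R x)" unfolding ss by simp
    moreover have "- 2 * s = - s + - s" by simp
    then have "(- 2 * s) *\<^sub>R x = (- s) *\<^sub>R x + (- s) *\<^sub>R x" by (simp only: scaleR_add_left)
    ultimately show ?thesis by (simp add: blinfun.diff_left x(2))
  qed
  have "- 2 * s \<noteq> 0" using s by auto
  then show False using cpt_no_inf_dim_eigenspace[OF cpt N infN _ eig] by blast
qed

definition even_nontrivial :: "('a::{real_inner,banach} \<Rightarrow>\<^sub>L 'a) \<Rightarrow> ('a \<Rightarrow>\<^sub>L 'a) \<Rightarrow> bool"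
  where "even_nontrivial L V \<longleftrightarrow> commutes V L \<and>
    inf_dim {x. L x = x \<and> V x = x} \<and> inf_dim {x. L x = x \<and> V x = - x} \<and>
    inf_dim {x. L x = 0 \<and> V x = x} \<and> inf_dim {x. L x = 0 \<and> V x = - x}"

lemma even_nontrivial_cpt:
  assumes V: "even_nontrivial L V" and W: "W \<in> saus G" "commutes W L" and cpt: "cpt (W - V)"
  shows "even_nontrivial L W"
proof -
  have sa: "selfadjoint W" "\<And>x. W (W x) = x" using W(1) by (auto simp: saus_def)
  have M: "subspace {x. L x = x}" "subspace {x. L x = 0}"
    by (simp_all add: subspace_def blinfun.add_right blinfun.scaleR_right)
  have inv: "W x \<in> {x. L x = x}" if "x \<in> {x. L x = x}" for x
    using commutesD[OF W(2), of x] that by simp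
  have inv0: "W x \<in> {x. L x = 0}" if "x \<in> {x. L x = 0}" for x
    using commutesD[OF W(2), of x] that by simp
  note * = inf_dim_eigenspace_cpt[OF M(1) inv sa cpt, of 1] inf_dim_eigenspace_cpt[OF M(1) inv sa cpt, of "-1"]
    inf_dim_eigenspace_cpt[OF M(2) inv0 sa cpt, of 1] inf_dim_eigenspace_cpt[OF M(2) inv0 sa cpt, of "-1"]
  show ?thesis
    using V W(2) * unfolding even_nontrivial_def by simp
qed

text \<open>Two sets of symmetries: \<open>U\<close> commutes with \<open>G\<close>, but the
  comparison operator \<open>V\<close> only with \<open>G\<^sub>0\<close>. In the application
  \<open>G\<^sub>0\<close> contains just \<open>iop\<close>, since \<Lambda>-non-triviality does not
  ask \<open>V\<close> to be real or quaternionic.\<close>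

definition nt_saus :: "('a::{real_inner,banach} \<Rightarrow>\<^sub>L 'a) set \<Rightarrow> ('a \<Rightarrow>\<^sub>L 'a) set \<Rightarrow> ('a \<Rightarrow>\<^sub>L 'a) \<Rightarrow> ('a \<Rightarrow>\<^sub>L 'a) set"
  where "nt_saus G\<^sub>0 G L = {U \<in> saus G. \<exists>V \<in> saus G\<^sub>0. even_nontrivial L V \<and> cpt (U - V)}"

context scalar_action
begin

text \<open>For projections with orthogonal ranges, the self-adjoint unitary whose eigenspace for 1
  is the sum of the ranges. The argument is a pair so that path-connectedness of a product set
  passes to the image.\<close>

definition join_projs :: "('a \<Rightarrow>\<^sub>L 'a) \<times> ('a \<Rightarrow>\<^sub>L 'a) \<Rightarrow> 'a \<Rightarrow>\<^sub>L 'a"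
  where "join_projs PQ = 2 *\<^sub>R fst PQ + 2 *\<^sub>R snd PQ - id_blinfun"

lemma admissible_compl: "admissible L \<Longrightarrow> admissible (id_blinfun - L)"
  unfolding admissible_def is_proj_def selfadjoint_def commutes_def
  by (simp add: blinfun.bilinear_simps inner_diff_left inner_diff_right)

lemma join_projs_even_nontrivial:
  assumes L: "admissible L" and P: "P \<in> half_projs L" and Q: "Q \<in> half_projs (id_blinfun - L)"
  shows "join_projs (P, Q) \<in> saus G" "even_nontrivial L (join_projs (P, Q))"
proof -
  note bl = blinfun.bilinear_simps
  let ?W = "join_projs (P, Q)"
  have Wx: "?W x = 2 *\<^sub>R P x + 2 *\<^sub>R Q x - x" for x by (simp add: join_projs_def bl)
  have pr: "is_proj L" "is_proj P" "is_proj Q"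
    and com: "\<And>g. g \<in> G \<Longrightarrow> commutes P g" "\<And>g. g \<in> G \<Longrightarrow> commutes Q g"
    using L P Q by (auto simp: half_projs_def admissible_def)
  have LP: "L (P x) = P x" and LQ: "L (Q x) = 0" for x
    using P Q by (auto simp: half_projs_def bl)
  have PL: "P (L x) = P x" for x by (rule half_projs_complement(1)[OF L P])
  have QL: "Q (L x) = 0" for x
    using half_projs_complement(1)[OF admissible_compl[OF L] Q, of x] by (simp add: bl)
  have PQ: "P (Q x) = 0" for x using PL[of "Q x"] by (simp add: LQ bl)
  have QP: "Q (P x) = 0" for x using QL[of "P x"] by (simp add: LP)
  note PP = is_projD(1)[OF pr(2)] and QQ = is_projD(1)[OF pr(3)] and LL = is_projD(1)[OF pr(1)]
  show "?W \<in> saus G"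
  proof (rule sausI)
    show "inner (?W x) z = inner x (?W z)" for x z
      by (simp add: Wx inner_add_left inner_add_right inner_diff_left inner_diff_right
          is_projD(2)[OF pr(2)] is_projD(2)[OF pr(3)])
    show "?W (?W x) = x" for x
      by (simp add: Wx bl PP QQ PQ QP algebra_simps scaleR_2)
    show "?W (g x) = g (?W x)" if "g \<in> G" for g x
      by (simp add: Wx bl commutesD[OF com(1)[OF that]] commutesD[OF com(2)[OF that]])
  qed
  have inf: "inf_dim (range P)" "inf_dim (range (L - P))" "inf_dim (range Q)" "inf_dim (range (id_blinfun - L - Q))"
    using P Q by (auto simp: half_projs_def)
  show "even_nontrivial L ?W"
    unfolding even_nontrivial_def
  proof (intro conjI)
    show "commutes ?W L" by (simp add: commutes_def Wx bl PL LP QL LQ)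
    show "inf_dim {x. L x = x \<and> ?W x = x}"
      by (rule inf_dim_mono[OF inf(1)]) (auto simp: Wx bl LP PP QP scaleR_2)
    show "inf_dim {x. L x = x \<and> ?W x = - x}"
      by (rule inf_dim_mono[OF inf(2)]) (auto simp: Wx bl LP PP QP PL QL LL)
    show "inf_dim {x. L x = 0 \<and> ?W x = x}"
      by (rule inf_dim_mono[OF inf(3)]) (auto simp: Wx bl LQ QQ PQ scaleR_2)
    show "inf_dim {x. L x = 0 \<and> ?W x = - x}"
      by (rule inf_dim_mono[OF inf(4)]) (auto simp: Wx bl LQ QQ PQ PL QL LL)
  qed
qed

lemma even_nontrivial_join_projs:
  assumes L: "admissible L" and W: "W \<in> saus G" "even_nontrivial L W"
  obtains P Q where "P \<in> half_projs L" "Q \<in> half_projs (id_blinfun - L)" "W = join_projs (P, Q)"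
proof -
  note bl = blinfun.bilinear_simps
  \<comment> \<open>(1 + W) N / 2 is the projection onto the part of the eigenspace of
    \<open>W\<close> for 1 inside the range of \<open>N\<close>; it is used for \<open>L\<close> and
    for its complement.\<close>
  define R1 where "R1 N = (1/2) *\<^sub>R (N + (W o\<^sub>L N))" for N :: "'a \<Rightarrow>\<^sub>L 'a"
  have R1x: "R1 N x = (1/2) *\<^sub>R (N x + W (N x))" for N x by (simp add: R1_def bl)
  have half: "(1/2) *\<^sub>R (x + x) = x" for x :: 'a by simp
  have WL: "W (L x) = L (W x)" for x using W(2) by (simp add: even_nontrivial_def commutes_def)
  have R1: "R1 N \<in> half_projs N"
    if N: "admissible N" "\<And>x. W (N x) = N (W x)" "inf_dim {x. N x = x \<and> W x = x}"
      "inf_dim {x. N x = x \<and> W x = - x}" for N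
  proof -
    have pr: "is_proj N" and com: "\<And>g. g \<in> G \<Longrightarrow> commutes N g"
      using N(1) by (auto simp: admissible_def)
    have "selfadjoint (R1 N)"
      by (simp add: selfadjoint_def R1x inner_add_left inner_add_right is_projD(2)[OF pr] sausD(1)[OF W(1)] N(2))
    moreover have "R1 N (R1 N x) = R1 N x" for x
      by (simp add: R1x bl N(2)[symmetric] is_projD(1)[OF pr] sausD(2)[OF W(1)] add.commute flip: scaleR_2)
    moreover have "commutes (R1 N) g" if "g \<in> G" for g
      by (simp add: commutes_def R1x bl commutesD[OF com[OF that]] sausD(3)[OF W(1) that])
    ultimately have "admissible (R1 N)" by (simp add: admissible_def is_proj_def)
    moreover have "N (R1 N x) = R1 N x" for x
      by (simp add: R1x bl N(2)[symmetric] is_projD(1)[OF pr])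
    moreover have "inf_dim (range (R1 N))"
    proof (rule inf_dim_mono[OF N(3)], clarify)
      fix x assume "N x = x" "W x = x"
      then have "R1 N x = x" by (simp add: R1x half)
      then show "x \<in> range (R1 N)" by (metis rangeI)
    qed
    moreover have "inf_dim (range (N - R1 N))"
    proof (rule inf_dim_mono[OF N(4)], clarify)
      fix x assume "N x = x" "W x = - x"
      then have "(N - R1 N) x = x" by (simp add: R1x bl)
      then show "x \<in> range (N - R1 N)" by (metis rangeI)
    qed
    ultimately show ?thesis by (simp add: half_projs_def)
  qed
  have "R1 L \<in> half_projs L"
    using W(2) by (intro R1 L WL) (auto simp: even_nontrivial_def)
  moreover have "R1 (id_blinfun - L) \<in> half_projs (id_blinfun - L)"
    using W(2) by (intro R1 admissible_compl L) (auto simp: even_nontrivial_def bl WL)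
  moreover have "W = join_projs (R1 L, R1 (id_blinfun - L))"
    by (rule blinfun_eqI) (simp add: join_projs_def bl R1x algebra_simps)
  ultimately show ?thesis using that by blast
qed

theorem path_connected_nt_saus:
  assumes G\<^sub>0: "G\<^sub>0 \<subseteq> G" and L: "admissible L"
    and inf: "inf_dim {x. L x = x}" "inf_dim {x. L x = 0}"
  shows "path_connected (nt_saus G\<^sub>0 G L)" "nt_saus G\<^sub>0 G L \<noteq> {}"
proof -
  let ?N = "nt_saus G\<^sub>0 G L"
  define J where "J = join_projs ` (half_projs L \<times> half_projs (id_blinfun - L))"
  have cL: "admissible (id_blinfun - L)" by (rule admissible_compl[OF L])
  have pr: "is_proj L" "is_proj (id_blinfun - L)" using L cL by (auto simp: admissible_def)
  have "inf_dim (range L)" "inf_dim (range (id_blinfun - L))"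
    using inf_dim_mono[OF inf(1), of "range L"] inf_dim_mono[OF inf(2), of "range (id_blinfun - L)"]
      is_proj_range[OF pr(1)] is_proj_range[OF pr(2)]
    by (auto simp: blinfun.diff_left)
  then have "J \<noteq> {}"
    unfolding J_def using half_projs_nonempty L cL by blast
  have "path_connected J"
    unfolding J_def
  proof (rule path_connected_continuous_image)
    show "continuous_on (half_projs L \<times> half_projs (id_blinfun - L)) join_projs"
      unfolding join_projs_def by (intro continuous_intros)
    show "path_connected (half_projs L \<times> half_projs (id_blinfun - L))"
      by (intro path_connected_Times path_connected_half_projs L cL)
  qed
  have JN: "J \<subseteq> ?N"
  proof
    fix W assume "W \<in> J"
    then have W: "W \<in> saus G" "even_nontrivial L W"
      using join_projs_even_nontrivial[OF L] by (auto simp: J_def)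
    \<comment> \<open>An element of \<open>J\<close> serves as its own comparison operator.\<close>
    then have "W \<in> saus G\<^sub>0" using G\<^sub>0 by (auto simp: saus_def)
    moreover have "cpt (W - W)" unfolding cpt_def by (intro exI[of _ "{0}"]) auto
    ultimately show "W \<in> ?N" using W by (auto simp: nt_saus_def)
  qed
  show "?N \<noteq> {}" using JN \<open>J \<noteq> {}\<close> by blast
  have to_J: "\<exists>W\<in>J. path_component ?N U W" if U: "U \<in> ?N" for U
  proof -
    obtain V where V: "V \<in> saus G\<^sub>0" "even_nontrivial L V" "cpt (U - V)" and US: "U \<in> saus G"
      using U by (auto simp: nt_saus_def)
    \<comment> \<open>\<open>V\<close> commutes with \<open>L\<close>, so \<open>U\<close> and the
      compact \<open>U - V\<close> have the same commutator with \<open>L\<close>.\<close>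
    have "(U o\<^sub>L L) - (L o\<^sub>L U) = ((U - V) o\<^sub>L L) - (L o\<^sub>L (U - V))"
      using V(2) by (intro blinfun_eqI)
        (simp add: blinfun.bilinear_simps even_nontrivial_def commutes_def)
    then have "cpt ((U o\<^sub>L L) - (L o\<^sub>L U))"
      by (simp only:) (intro cpt_diff cpt_compose_left cpt_compose_right[OF V(3)] V(3))
    from deform_to_commuting[OF pr(1) G_pm _ US this] L obtain W
      where W: "W \<in> saus G" "commutes W L" "path_component {W \<in> saus G. cpt (W - U)} U W"
      unfolding admissible_def by blast
    have cptV: "cpt (W' - V)" if "cpt (W' - U)" for W'
      using cpt_add[OF that V(3)] by simp
    have "{W \<in> saus G. cpt (W - U)} \<subseteq> ?N"
      using V(1,2) cptV by (auto simp: nt_saus_def)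
    then have pc: "path_component ?N U W" using W(3) path_component_of_subset by blast
    have "cpt (W - U)" using path_component_mem(2)[OF W(3)] by simp
    \<comment> \<open>The comparison operator \<open>V\<close> need not commute with
      \<open>G\<close>, but \<open>W\<close> does and inherits infinite-dimensional eigenspaces from
      it; from here on \<open>V\<close> is no longer needed for \<open>W\<close>.\<close>
    then have "even_nontrivial L W"
      using even_nontrivial_cpt[OF V(2) W(1,2)] cptV by blast
    then have "W \<in> J"
      using even_nontrivial_join_projs[OF L W(1)] unfolding J_def by blast
    then show ?thesis using pc by blast
  qed
  show "path_connected ?N"
    unfolding path_connected_component
  proof (intro ballI)
    fix U U' assume "U \<in> ?N" "U' \<in> ?N"
    then obtain W W' where W: "W \<in> J" "path_component ?N U W" "W' \<in> J" "path_component ?N U' W'"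
      using to_J by meson
    then have "path_component J W W'"
      using \<open>path_connected J\<close> unfolding path_connected_component by blast
    then have "path_component ?N W W'" using JN path_component_of_subset by blast
    then show "path_component ?N U U'"
      using W(2,4) by (meson path_component_sym path_component_trans)
  qed
qed

end

section \<open>Complex, real and quaternionic scalars\<close>

lemma cinner_scaleC_left: "cinner (a *\<^sub>C x) y = cnj a * cinner x (y::'a::complex_hilbert_space)"
  by (metis cinner_commute cinner_scaleC_right complex_cnj_mult)

definition iop :: "'a::complex_hilbert_space \<Rightarrow>\<^sub>L 'a"
  where "iop = Blinfun (scaleC \<i>)"

lemma scaleC_scaleR: "a *\<^sub>C (r *\<^sub>R x) = r *\<^sub>R (a *\<^sub>C (x::'a::complex_hilbert_space))"
  by (simp add: scaleR_scaleC scaleC_scaleC mult.commute)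

lemma scaleC_minus_one: "(- 1) *\<^sub>C x = - (x::'a::complex_hilbert_space)"
  using scaleR_scaleC[of "-1" x] by simp

lemma inner_scaleC_i: "inner (\<i> *\<^sub>C x) (\<i> *\<^sub>C y) = inner x (y::'a::complex_hilbert_space)"
  by (simp add: inner_eq_Re_cinner cinner_scaleC_left cinner_scaleC_right)

lemma isometry_bounded_linear:
  fixes f :: "'a::real_inner \<Rightarrow> 'a"
  assumes "\<And>x y. f (x + y) = f x + f y" "\<And>r x. f (r *\<^sub>R x) = r *\<^sub>R f x"
    and "\<And>x. inner (f x) (f x) = inner x x"
  shows "bounded_linear f"
  using assms by (intro bounded_linear_intro[where K = 1]) (auto simp: norm_eq_sqrt_inner)

lemma iop_apply [simp]: "iop x = \<i> *\<^sub>C (x::'a::complex_hilbert_space)"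
  unfolding iop_def
  by (subst bounded_linear_Blinfun_apply)
    (auto intro!: isometry_bounded_linear simp: scaleC_add_right scaleC_scaleR inner_scaleC_i)

lemma scaleC_i_i: "\<i> *\<^sub>C \<i> *\<^sub>C x = - (x::'a::complex_hilbert_space)"
  by (simp add: scaleC_scaleC scaleC_minus_one)

lemma inner_scaleC_i_left: "inner (\<i> *\<^sub>C x) y = - inner x (\<i> *\<^sub>C (y::'a::complex_hilbert_space))"
  by (simp add: inner_eq_Re_cinner cinner_scaleC_left cinner_scaleC_right)

lemma cinner_eq: "cinner x y = Complex (inner x y) (- inner x (\<i> *\<^sub>C (y::'a::complex_hilbert_space)))"
  by (simp add: complex_eq_iff inner_eq_Re_cinner cinner_scaleC_right)

lemma scaleC_eq: "a *\<^sub>C x = Re a *\<^sub>R x + Im a *\<^sub>R (\<i> *\<^sub>C (x::'a::complex_hilbert_space))"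
proof -
  have "Re a *\<^sub>R x + Im a *\<^sub>R (\<i> *\<^sub>C x) = (complex_of_real (Re a) + complex_of_real (Im a) * \<i>) *\<^sub>C x"
    by (simp only: scaleR_scaleC scaleC_scaleC scaleC_add_left)
  also have "complex_of_real (Re a) + complex_of_real (Im a) * \<i> = a"
    by (simp add: complex_eq_iff)
  finally show ?thesis by simp
qed

lemma commutes_iop_iff: "commutes U iop \<longleftrightarrow> (\<forall>a x. U (a *\<^sub>C x) = a *\<^sub>C U (x::'a::complex_hilbert_space))"
proof
  assume "commutes U iop"
  then have i: "U (\<i> *\<^sub>C x) = \<i> *\<^sub>C U x" for x by (simp add: commutes_def)
  have "U (a *\<^sub>C x) = a *\<^sub>C U x" for a x
    unfolding scaleC_eq[of a x] scaleC_eq[of a "U x"] by (simp only: blinfun.add_right blinfun.scaleR_right i)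
  then show "\<forall>a x. U (a *\<^sub>C x) = a *\<^sub>C U x" by blast
qed (simp add: commutes_def)

lemma clinear_iff: "clinear (blinfun_apply U) \<longleftrightarrow> commutes U iop"
proof -
  have "clinear (blinfun_apply U) \<longleftrightarrow> (\<forall>a x. U (a *\<^sub>C x) = a *\<^sub>C U x)"
    unfolding clinear_def Vector_Spaces.linear_def module_hom_def module_hom_axioms_def
    by (auto simp: complex_vector.vector_space_axioms complex_vector.module_axioms blinfun.add_right)
  then show ?thesis by (simp add: commutes_iop_iff)
qed

text \<open>A finite set that spans over the reals also spans over the complex numbers; conversely
  the complex span of \<open>B\<close> is contained in the real span of \<open>B\<close> together
  with its multiples by \<i>.\<close>

lemma inf_dim_iff:
  fixes S :: "'a::complex_hilbert_space set"
  assumes S: "complex_vector.subspace S"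
  shows "infinite_dimensional S \<longleftrightarrow> inf_dim S"
proof
  assume inf: "infinite_dimensional S"
  show "inf_dim S"
    unfolding inf_dim_def
  proof
    assume "\<exists>B. finite B \<and> S \<subseteq> span B"
    then obtain B where B: "finite B" "S \<subseteq> span B" by blast
    have "subspace (complex_vector.span B)"
      unfolding subspace_def
      by (simp add: complex_vector.span_zero complex_vector.span_add complex_vector.span_scale scaleR_scaleC)
    then have "span B \<subseteq> complex_vector.span B"
      by (intro span_minimal complex_vector.span_superset)
    then have SB: "S \<subseteq> complex_vector.span B" using B(2) by blast
    \<comment> \<open>\<open>infinite_dimensional\<close> refers to sets whose span equals
      \<open>S\<close>, whereas \<open>B\<close> need not lie in \<open>S\<close>; it is replaced by
      a basis of \<open>S\<close>, which is finite by comparison with \<open>B\<close>.\<close>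
    obtain C where C: "C \<subseteq> S" "complex_vector.independent C" "S \<subseteq> complex_vector.span C"
      by (rule complex_vector.maximal_independent_subset)
    have "complex_vector.span C = S"
      using complex_vector.span_minimal[OF C(1) S] C(3) by blast
    moreover have "finite C"
      using complex_vector.independent_span_bound[OF B(1) C(2)] C(1) SB by blast
    ultimately show False using inf unfolding infinite_dimensional_def by blast
  qed
next
  assume inf: "inf_dim S"
  show "infinite_dimensional S"
    unfolding infinite_dimensional_def
  proof
    assume "\<exists>B. finite B \<and> complex_vector.span B = S"
    then obtain B where B: "finite B" "complex_vector.span B = S" by blast
    let ?X = "B \<union> iop ` B"
    have i: "\<i> *\<^sub>C x \<in> span ?X" if "x \<in> span ?X" for x
    proof -
      have "subspace {x. \<i> *\<^sub>C x \<in> span ?X}"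
        by (simp add: subspace_def scaleC_add_right scaleC_scaleR span_add span_scale span_zero)
      moreover have "\<i> *\<^sub>C y \<in> span ?X" if "y \<in> ?X" for y
      proof -
        from that consider "y \<in> B" | b where "b \<in> B" "y = \<i> *\<^sub>C b" by auto
        then show ?thesis
        proof cases
          case 1
          then have "\<i> *\<^sub>C y \<in> ?X" by auto
          then show ?thesis by (rule span_base)
        next
          case 2
          then have "b \<in> span ?X" by (simp add: span_base)
          then show ?thesis using 2 by (simp add: scaleC_i_i span_neg)
        qed
      qed
      then have "?X \<subseteq> {x. \<i> *\<^sub>C x \<in> span ?X}" by blast
      ultimately have "span ?X \<subseteq> {x. \<i> *\<^sub>C x \<in> span ?X}" by (intro span_minimal)
      then show ?thesis using that by blast
    qed
    have "a *\<^sub>C x \<in> span ?X" if "x \<in> span ?X" for a x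
      unfolding scaleC_eq[of a x] by (intro span_add span_scale i[OF that] that)
    then have "complex_vector.subspace (span ?X)"
      unfolding complex_vector.subspace_def by (simp add: span_zero span_add)
    then have "complex_vector.span B \<subseteq> span ?X"
      using span_superset[of ?X] by (intro complex_vector.span_minimal) blast+
    moreover have "finite ?X" using B(1) by simp
    ultimately show False using inf B(2) unfolding inf_dim_def by blast
  qed
qed

text \<open>For a self-adjoint operator, preserving the scalar product amounts to being an
  involution, and an involution is onto. The complex scalar product is recovered from the real one
  by \<open>cinner_eq\<close>.\<close>

lemma sau_on_UNIV_iff: "sau_on UNIV (blinfun_apply U) \<longleftrightarrow> U \<in> saus {iop}"
proof
  assume U: "sau_on UNIV (blinfun_apply U)"
  show "U \<in> saus {iop}"
  proof (rule sausI)
    show sa: "inner (U x) z = inner x (U z)" for x z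
      using U by (simp add: sau_on_def inner_eq_Re_cinner)
    have "inner (U x) (U z) = inner x z" for x z
      using U unfolding sau_on_def inner_eq_Re_cinner by auto
    then have "inner (U (U x) - x) z = 0" for x z
      unfolding inner_diff_left sa[of "U x" z] by simp
    then show "U (U x) = x" for x by (metis inner_eq_zero_iff right_minus_eq)
    show "U (g x) = g (U x)" if "g \<in> {iop}" for g x
      using U that by (simp add: sau_on_def)
  qed
next
  assume U: "U \<in> saus {iop}"
  have i: "U (\<i> *\<^sub>C x) = \<i> *\<^sub>C U x" for x using sausD(3)[OF U, of iop] by simp
  have "commutes U iop" using U by (simp add: saus_def)
  then have sc: "U (a *\<^sub>C x) = a *\<^sub>C U x" for a x by (simp add: commutes_iop_iff)
  have "cinner (U x) (U y) = cinner x y" "cinner (U x) y = cinner x (U y)" for x y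
    using sausD(1)[OF U] sausD(2)[OF U] by (simp_all add: cinner_eq flip: i)
  moreover have "range U = UNIV" using sausD(2)[OF U] by (metis surjI)
  ultimately show "sau_on UNIV (blinfun_apply U)"
    by (simp add: sau_on_def blinfun.add_right sc)
qed

lemma nontrivial_sau_on_iff:
  fixes V :: "'a::complex_hilbert_space \<Rightarrow>\<^sub>L 'a"
  assumes V: "V \<in> saus {iop}" and N: "complex_vector.subspace N" "\<And>x. x \<in> N \<Longrightarrow> V x \<in> N"
  shows "nontrivial_sau_on N (blinfun_apply V) \<longleftrightarrow>
    inf_dim {x\<in>N. V x = x} \<and> inf_dim {x\<in>N. V x = - x}"
proof -
  have "V ` N = N"
    using N(2) sausD(2)[OF V] by (metis image_subset_iff image_eqI subsetI subset_antisym)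
  then have "sau_on N (blinfun_apply V)"
    using V unfolding sau_on_UNIV_iff[symmetric] sau_on_def by blast
  moreover have "complex_vector.subspace {x\<in>N. V x = x}" "complex_vector.subspace {x\<in>N. V x = - x}"
    using N(1) V unfolding sau_on_UNIV_iff[symmetric]
    by (auto simp: complex_vector.subspace_def sau_on_def blinfun.add_right
        complex_vector.scale_minus_right)
  ultimately show ?thesis by (simp add: nontrivial_sau_on_def inf_dim_iff)
qed

lemma selfadjoint_projectionD:
  assumes "selfadjoint_projection L"
  shows "is_proj L" "commutes L iop"
  using assms unfolding selfadjoint_projection_def
  by (auto simp: clinear_iff is_proj_def selfadjoint_def inner_eq_Re_cinner dest: blinfun_apply_inject[THEN iffD2])
    (metis blinfun_apply_blinfun_compose)

lemma \<Lambda>_nontrivial_iff: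
  assumes L: "selfadjoint_projection L" and U: "U \<in> saus {iop}"
  shows "\<Lambda>_nontrivial L U \<longleftrightarrow> (\<exists>V\<in>saus {iop}. even_nontrivial L V \<and> cpt (U - V))"
proof -
  note pr = selfadjoint_projectionD[OF L]
  have range_L: "range (blinfun_apply L) = {x. L x = x}" using is_proj_range[OF pr(1)] by auto
  have "y \<in> range (\<lambda>x. x - L x)" if "L y = 0" for y
    using that by (intro image_eqI[of _ _ y]) auto
  then have range_C: "range (blinfun_apply (id_blinfun - L)) = {x. L x = 0}"
    using is_projD(1)[OF pr(1)] by (auto simp: blinfun.bilinear_simps)
  have iL: "L (a *\<^sub>C x) = a *\<^sub>C L x" for a x using pr(2) by (simp add: commutes_iop_iff)
  have sub: "complex_vector.subspace {x. L x = x}" "complex_vector.subspace {x. L x = 0}"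
    by (auto simp: complex_vector.subspace_def blinfun.add_right iL)
  have "sau_on UNIV (blinfun_apply V) \<and> V o\<^sub>L L = L o\<^sub>L V \<and>
      nontrivial_sau_on (range (blinfun_apply L)) (blinfun_apply V) \<and>
      nontrivial_sau_on (range (blinfun_apply (id_blinfun - L))) (blinfun_apply V) \<and>
      compact_operator (U - V) \<longleftrightarrow> V \<in> saus {iop} \<and> even_nontrivial L V \<and> cpt (U - V)" for V
  proof (cases "V \<in> saus {iop} \<and> commutes V L")
    case True
    then have V: "V \<in> saus {iop}" "commutes V L" by auto
    have inv: "V x \<in> {x. L x = x}" if "x \<in> {x. L x = x}" for x
      using commutesD[OF V(2), of x] that by simp
    have inv0: "V x \<in> {x. L x = 0}" if "x \<in> {x. L x = 0}" for x
      using commutesD[OF V(2), of x] that by simp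
    have "V o\<^sub>L L = L o\<^sub>L V"
      using V(2) by (intro blinfun_eqI) (simp add: commutes_def)
    moreover have "commutes (U - V) iop"
      using sausD(3)[OF U, of iop] sausD(3)[OF V(1), of iop]
      by (simp add: commutes_def blinfun.diff_left complex_vector.scale_right_diff_distrib)
    then have "compact_operator (U - V) \<longleftrightarrow> cpt (U - V)"
      by (simp add: compact_operator_def clinear_iff cpt_iff_compact_closure)
    ultimately show ?thesis
      using V nontrivial_sau_on_iff[OF V(1) sub(1) inv] nontrivial_sau_on_iff[OF V(1) sub(2) inv0]
      unfolding range_L range_C sau_on_UNIV_iff even_nontrivial_def by simp
  next
    case False
    have "commutes V L" if "V o\<^sub>L L = L o\<^sub>L V"
      using that by (metis blinfun_apply_blinfun_compose commutes_def)
    then show ?thesis using False unfolding sau_on_UNIV_iff even_nontrivial_def by blast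
  qed
  then show ?thesis unfolding \<Lambda>_nontrivial_def by blast
qed

lemma \<Lambda>nt_saus_eq: "selfadjoint_projection L \<Longrightarrow> \<Lambda>nt_saus L = nt_saus {iop} {iop} L"
  unfolding \<Lambda>nt_saus_def nt_saus_def sau_on_UNIV_iff using \<Lambda>_nontrivial_iff by blast

section \<open>Antiunitary operators and the three scalar actions\<close>

lemma antiunitaryD:
  assumes f: "antiunitary f"
  shows "bounded_linear f" "f (\<i> *\<^sub>C x) = - (\<i> *\<^sub>C f x)" "inner (f x) (f y) = inner x y"
proof -
  have add: "f (x + y) = f x + f y" and sc: "f (a *\<^sub>C x) = cnj a *\<^sub>C f x"
    and ip: "inner (f x) (f y) = inner x y" for a x y
    using f by (simp_all add: antiunitary_def inner_eq_Re_cinner)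
  show "inner (f x) (f y) = inner x y" by (rule ip)
  show "f (\<i> *\<^sub>C x) = - (\<i> *\<^sub>C f x)" by (simp add: sc complex_vector.scale_minus_left)
  show "bounded_linear f"
    by (rule isometry_bounded_linear) (simp_all add: add ip sc scaleR_scaleC)
qed

lemma commutes_Blinfun_iff:
  assumes "antiunitary f"
  shows "blinfun_apply U \<circ> f = f \<circ> blinfun_apply U \<longleftrightarrow> commutes U (Blinfun f)"
  by (auto simp: commutes_def bounded_linear_Blinfun_apply[OF antiunitaryD(1)[OF assms]] fun_eq_iff)

lemma inner_scaleC_i_self: "inner x (\<i> *\<^sub>C x) = 0" "inner (\<i> *\<^sub>C x) x = 0"
  using inner_scaleC_i_left[of x x] by (simp_all add: inner_commute)

lemma pm_symmetric_iop: "pm_symmetric iop"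
  unfolding pm_symmetric_def by (intro exI[of _ "-1"]) (simp add: inner_scaleC_i_left)

context
  assumes sep: "\<exists>A::'a::complex_hilbert_space set. countable A \<and> closure A = UNIV"
begin

lemma scalar_action_complex: "scalar_action {iop} {id_blinfun, iop} (UNIV :: 'a set)"
proof
  show "\<exists>A::'a set. countable A \<and> closure A = UNIV" by (rule sep)
  show "inner (blinfun_apply d x) (blinfun_apply d' x) = (if d = d' then inner x x else 0)"
    if "d \<in> {id_blinfun, iop}" "d' \<in> {id_blinfun, iop}" for d d' and x :: 'a
    using that by (auto simp: inner_scaleC_i inner_scaleC_i_self)
  show "\<exists>d'\<in>{id_blinfun, iop}. \<exists>r. \<forall>x\<in>UNIV. g (blinfun_apply d x) = r *\<^sub>R blinfun_apply d' (x::'a)"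
    if "g \<in> {iop}" "d \<in> {id_blinfun, iop}" for g d
    using that by (auto simp: scaleC_i_i intro: exI[of _ 1] exI[of _ "-1"])
qed (auto simp: pm_symmetric_iop)

text \<open>On vectors fixed by \<open>C\<close> the operators in \<open>G\<close> generate only x
  and \<i> x, so \<open>D\<close> is the same as in the complex case and the real structure shows in
  the choice of \<open>R\<close>.\<close>

lemma scalar_action_real:
  fixes C :: "'a \<Rightarrow> 'a"
  assumes C: "antiunitary C" "C \<circ> C = id"
  shows "scalar_action {iop, Blinfun C} {id_blinfun, iop} {x. C x = x}"
proof
  have CC: "C (C x) = x" for x using C(2) by (metis comp_apply id_apply)
  note bC [simp] = bounded_linear_Blinfun_apply[OF antiunitaryD(1)[OF C(1)]]
  note Ci = antiunitaryD(2)[OF C(1)] and Cinner = antiunitaryD(3)[OF C(1)]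
  have lin: "linear C" using antiunitaryD(1)[OF C(1)] bounded_linear.linear by blast
  show "\<exists>A::'a set. countable A \<and> closure A = UNIV" by (rule sep)
  have "inner (C x) y = 1 * inner x (C y)" for x y using Cinner[of x "C y"] by (simp add: CC)
  then have "pm_symmetric (Blinfun C)" unfolding pm_symmetric_def bC by (intro exI[of _ 1] allI)
  then show "pm_symmetric g" if "g \<in> {iop, Blinfun C}" for g
    using that pm_symmetric_iop by auto
  show "inner (blinfun_apply d x) (blinfun_apply d' x) = (if d = d' then inner x x else 0)"
    if "d \<in> {id_blinfun, iop}" "d' \<in> {id_blinfun, iop}" for d d' and x :: 'a
    using that by (auto simp: inner_scaleC_i inner_scaleC_i_self)
  show "\<exists>d'\<in>{id_blinfun, iop}. \<exists>r. \<forall>x\<in>{x. C x = x}. g (blinfun_apply d x) = r *\<^sub>R blinfun_apply d' (x::'a)"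
    if "g \<in> {iop, Blinfun C}" "d \<in> {id_blinfun, iop}" for g d
    using that by (auto simp: scaleC_i_i Ci intro: exI[of _ 1] exI[of _ "-1"])
  show "\<exists>y\<in>S \<inter> {x. C x = x}. y \<noteq> 0"
    if S: "subspace S" and inv: "\<And>g x. g \<in> {iop, Blinfun C} \<Longrightarrow> x \<in> S \<Longrightarrow> g x \<in> S"
      and x: "x \<in> S" "x \<noteq> 0" for S x
  \<comment> \<open>Normally x + C x is the required fixed vector. If it vanishes, then C x = - x,
    and antilinearity makes \<i> x fixed.\<close>
  proof (cases "x + C x = 0")
    case True
    then have "C x = - x" by (simp add: eq_neg_iff_add_eq_0 add.commute)
    then have "C (\<i> *\<^sub>C x) = \<i> *\<^sub>C x" by (simp add: Ci complex_vector.scale_minus_right)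
    moreover have "\<i> *\<^sub>C x \<noteq> 0" using inner_scaleC_i[of x x] x(2) by auto
    moreover have "\<i> *\<^sub>C x \<in> S" using inv[of iop x] x(1) by simp
    ultimately show ?thesis by blast
  next
    case False
    moreover have "C (x + C x) = x + C x" by (simp add: linear_add[OF lin] CC add.commute)
    moreover have "x + C x \<in> S" using inv[of "Blinfun C" x] x(1) S by (simp add: subspace_add)
    ultimately show ?thesis by blast
  qed
  show "r *\<^sub>R x \<in> {x. C x = x}" if "x \<in> {x. C x = x}" for r x
    using that by (simp add: linear_scale[OF lin])
qed auto

text \<open>Multiplication by \<i>, \<open>J\<close> and their product are antisymmetric for the
  real inner product and permute the four vectors x, \<i> x, J x, \<i> J x up to sign. These vectors
  are thus orthogonal for every \<open>x\<close>, so that \<open>R\<close> can be the whole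
  space.\<close>

lemma scalar_action_quaternionic:
  fixes J :: "'a \<Rightarrow> 'a"
  assumes J: "antiunitary J" "J \<circ> J = uminus"
  shows "scalar_action {iop, Blinfun J} {id_blinfun, iop, Blinfun J, iop o\<^sub>L Blinfun J} UNIV"
proof
  have JJ: "J (J x) = - x" for x using J(2) by (metis comp_apply)
  note bJ [simp] = bounded_linear_Blinfun_apply[OF antiunitaryD(1)[OF J(1)]]
  note Ji = antiunitaryD(2)[OF J(1)] and Jinner = antiunitaryD(3)[OF J(1)]
  have lin: "linear J" using antiunitaryD(1)[OF J(1)] bounded_linear.linear by blast
  show "\<exists>A::'a set. countable A \<and> closure A = UNIV" by (rule sep)
  have Jleft: "inner (J x) y = - inner x (J y)" for x y
    using Jinner[of x "J y"] by (simp add: JJ inner_minus_right)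
  have "inner (J x) y = -1 * inner x (J y)" for x y using Jleft by simp
  then have "pm_symmetric (Blinfun J)" unfolding pm_symmetric_def bJ by (intro exI[of _ "-1"] allI)
  then show "pm_symmetric g" if "g \<in> {iop, Blinfun J}" for g
    using that pm_symmetric_iop by auto
  have xJ: "inner x (J x) = 0" "inner (J x) x = 0" for x
    using Jleft[of x x] by (simp_all add: inner_commute)
  have xiJ: "inner x (\<i> *\<^sub>C J x) = 0" "inner (\<i> *\<^sub>C J x) x = 0" for x
  proof -
    have "inner (\<i> *\<^sub>C J x) x = - inner x (\<i> *\<^sub>C J x)"
      by (simp add: inner_scaleC_i_left Jleft Ji)
    then show "inner x (\<i> *\<^sub>C J x) = 0" "inner (\<i> *\<^sub>C J x) x = 0" by (simp_all add: inner_commute)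
  qed
  have iJ: "inner (\<i> *\<^sub>C x) (J x) = 0" "inner (J x) (\<i> *\<^sub>C x) = 0" for x
    using xiJ[of x] by (simp_all add: inner_scaleC_i_left inner_commute[of "J x"])
  let ?D = "{id_blinfun, iop, Blinfun J, iop o\<^sub>L Blinfun J}"
  show "inner (blinfun_apply d x) (blinfun_apply d' x) = (if d = d' then inner x x else 0)"
    if "d \<in> ?D" "d' \<in> ?D" for d d' and x :: 'a
  proof (cases "d = d'")
    case True
    then show ?thesis using that(2) by (auto simp: inner_scaleC_i Jinner)
  next
    case False
    then show ?thesis
      using that by (elim insertE emptyE) (auto simp: inner_scaleC_i inner_scaleC_i_self xJ xiJ iJ)
  qed
  show "\<exists>d'\<in>?D. \<exists>r. \<forall>x\<in>UNIV. g (blinfun_apply d x) = r *\<^sub>R blinfun_apply d' (x::'a)"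
    if "g \<in> {iop, Blinfun J}" "d \<in> ?D" for g d
    using that
  proof (elim insertE emptyE)
    assume "g = iop" "d = id_blinfun" then show ?thesis
      by (intro bexI[of _ iop] exI[of _ 1]) auto
  next
    assume "g = iop" "d = iop" then show ?thesis
      by (intro bexI[of _ id_blinfun] exI[of _ "-1"]) (auto simp: scaleC_i_i)
  next
    assume "g = iop" "d = Blinfun J" then show ?thesis
      by (intro bexI[of _ "iop o\<^sub>L Blinfun J"] exI[of _ 1]) auto
  next
    assume "g = iop" "d = iop o\<^sub>L Blinfun J" then show ?thesis
      by (intro bexI[of _ "Blinfun J"] exI[of _ "-1"]) (auto simp: scaleC_i_i)
  next
    assume "g = Blinfun J" "d = id_blinfun" then show ?thesis
      by (intro bexI[of _ "Blinfun J"] exI[of _ 1]) auto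
  next
    assume "g = Blinfun J" "d = iop" then show ?thesis
      by (intro bexI[of _ "iop o\<^sub>L Blinfun J"] exI[of _ "-1"]) (auto simp: Ji)
  next
    assume "g = Blinfun J" "d = Blinfun J" then show ?thesis
      by (intro bexI[of _ id_blinfun] exI[of _ "-1"]) (auto simp: JJ)
  next
    assume "g = Blinfun J" "d = iop o\<^sub>L Blinfun J" then show ?thesis
      by (intro bexI[of _ iop] exI[of _ 1]) (auto simp: Ji JJ complex_vector.scale_minus_right)
  qed
  show "blinfun_apply d x \<in> S"
    if d: "d \<in> ?D" and inv: "\<And>g x. g \<in> {iop, Blinfun J} \<Longrightarrow> x \<in> S \<Longrightarrow> blinfun_apply g x \<in> S" and x: "x \<in> S"
    for d S x
    using d inv[of iop x] inv[of "Blinfun J" x] inv[of iop "J x"] x by auto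
qed auto

end

theorem theorem4p2:
  fixes \<Lambda> :: "'a::complex_hilbert_space \<Rightarrow>\<^sub>L 'a"
    and C J :: "'a \<Rightarrow> 'a"
    and F :: scalar_class
  assumes "infinite_dimensional (UNIV :: 'a set)"
    and "separable_space (euclidean :: 'a topology)"
    and "selfadjoint_projection \<Lambda>"
    and "infinite_dimensional (range (blinfun_apply \<Lambda>))"
    and "infinite_dimensional {x. \<Lambda> x = 0}"
    and "antiunitary C" and "C \<circ> C = id" and "C \<circ> blinfun_apply \<Lambda> = blinfun_apply \<Lambda> \<circ> C"
    and "antiunitary J" and "J \<circ> J = uminus" and "J \<circ> blinfun_apply \<Lambda> = blinfun_apply \<Lambda> \<circ> J"
  shows "card (pi0 (\<Lambda>nt_saus_of_class F \<Lambda> C J)) = 1"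
proof -
  have sep: "\<exists>A::'a set. countable A \<and> closure A = UNIV"
    using assms(2) by (auto simp: separable_space_def)
  note pr = selfadjoint_projectionD[OF assms(3)]
  have iL: "\<Lambda> (a *\<^sub>C x) = a *\<^sub>C \<Lambda> x" for a x using pr(2) by (simp add: commutes_iop_iff)
  have sub: "complex_vector.subspace {x. \<Lambda> x = x}" "complex_vector.subspace {x. \<Lambda> x = 0}"
    by (auto simp: complex_vector.subspace_def blinfun.add_right iL)
  have "range (blinfun_apply \<Lambda>) = {x. \<Lambda> x = x}" using is_proj_range[OF pr(1)] by auto
  then have inf: "inf_dim {x. \<Lambda> x = x}" "inf_dim {x. \<Lambda> x = 0}"
    using assms(4,5) by (simp_all add: inf_dim_iff sub)
  have comm: "commutes \<Lambda> (Blinfun C)" "commutes \<Lambda> (Blinfun J)"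
    using assms(8,11) commutes_Blinfun_iff[OF assms(6)] commutes_Blinfun_iff[OF assms(9)] by metis+
  have "path_connected (\<Lambda>nt_saus_of_class F \<Lambda> C J) \<and> \<Lambda>nt_saus_of_class F \<Lambda> C J \<noteq> {}"
  proof (cases F)
    case Class_C
    interpret scalar_action "{iop}" "{id_blinfun, iop}" "UNIV :: 'a set"
      by (rule scalar_action_complex[OF sep])
    have "admissible \<Lambda>" using pr by (simp add: admissible_def)
    from path_connected_nt_saus[OF subset_refl this inf] show ?thesis
      by (simp add: Class_C \<Lambda>nt_saus_eq[OF assms(3)])
  next
    case Class_R
    interpret scalar_action "{iop, Blinfun C}" "{id_blinfun, iop}" "{x. C x = x}"
      by (rule scalar_action_real[OF sep assms(6,7)])
    have "admissible \<Lambda>" using pr comm by (simp add: admissible_def)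
    moreover have "\<Lambda>nt_saus_of_class F \<Lambda> C J = nt_saus {iop} {iop, Blinfun C} \<Lambda>"
      by (auto simp: Class_R \<Lambda>nt_saus_eq[OF assms(3)] nt_saus_def saus_def commutes_Blinfun_iff[OF assms(6)])
    ultimately show ?thesis
      using path_connected_nt_saus[of "{iop}" \<Lambda>] inf by simp
  next
    case Class_H
    interpret scalar_action "{iop, Blinfun J}" "{id_blinfun, iop, Blinfun J, iop o\<^sub>L Blinfun J}" "UNIV :: 'a set"
      by (rule scalar_action_quaternionic[OF sep assms(9,10)])
    have "admissible \<Lambda>" using pr comm by (simp add: admissible_def)
    moreover have "\<Lambda>nt_saus_of_class F \<Lambda> C J = nt_saus {iop} {iop, Blinfun J} \<Lambda>"
      by (auto simp: Class_H \<Lambda>nt_saus_eq[OF assms(3)] nt_saus_def saus_def commutes_Blinfun_iff[OF assms(9)])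
    ultimately show ?thesis
      using path_connected_nt_saus[of "{iop}" \<Lambda>] inf by simp
  qed
  \<comment> \<open>Nonemptiness matters here: the empty set is path-connected but has no path
    component.\<close>
  then have "pi0 (\<Lambda>nt_saus_of_class F \<Lambda> C J) = {\<Lambda>nt_saus_of_class F \<Lambda> C J}"
    unfolding pi0_def path_components_of_eq_singleton
    by (simp add: path_connectedin_euclidean[unfolded path_connectedin_def])
  then show ?thesis by simp
qed

end
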